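(* Let $h\colon[n]\to[n]$ be a Hessenberg function and let $w\in\mathfrak S_n$ be any permutation. The graph $\Gamma_{w,h}$ is regular if and only if $w$ avoids all of the associated patterns $[2143]_h$, $[1324]_h$, $[1243]_h$, $[2134]_h$, $[1423]_h$, $[2314]_h$, $[25314]_h$, $[24315]_h$, $[14325]_h$, and $[15324]_h$.
   Context: A Hessenberg function is a nondecreasing $h\colon[n]\to[n]$ with $h(i)\ge i$. For $u\in\mathfrak S_n$ (one-line notation) and $i<j$, $u(i,j)$ is obtained from $u$ by swapping the entries in positions $i$ and $j$. The Bruhat order $\preceq$ is the reflexive–transitive closure of $u\prec u(i,j)$ when $u(i,j)$ has more inversions than $u$; $w_0=n(n-1)\cdots1$, $[v,w_0]=\{u\mid v\preceq u\preceq w_0\}$. A generator for $h$ is a $w$ with $w^{-1}(w(i)+1)\le h(i)$ whenever $w(i)\le n-1$. For each $w\in\mathfrak S_n$ there is a unique generator $\widetilde w$ (the corresponding generator) such that for all $i<j$ with $j\le h(i)$: $\widetilde w(i)<\widetilde w(j)$ iff $w(i)<w(j)$. $\Gamma_h$ is the graph with vertex set $\mathfrak S_n$ and edges $\{u,u(i,j)\}$ for $1\le i<j\le h(i)$; $\Gamma_{w,h}$ is the subgraph of $\Gamma_h$ induced on the vertex set $\{w\widetilde w^{-1}u\mid u\in[\widetilde w,w_0]\}$ (product = composition of permutations; this is the set of torus fixed points of the Hessenberg Schubert variety $\Omega_{w,h}$, and equals $[w,w_0]$ when $w$ is a generator). A graph is regular if all vertices have the same degree. Associated patterns: $w$ contains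 $[2143]_h$ if $w(j)<w(i)<w(\ell)<w(k)$ for some $i<j<k<\ell\le h(i)$; $[1324]_h$ if $w(i)<w(k)<w(j)<w(\ell)$ for some $i<j<k<\ell\le h(j)$ with $k\le h(i)$; $[1243]_h$ if $w(i)<w(j)<w(\ell)<w(k)$ for some $i<j<k<\ell\le h(j)$ with $j\le h(i)<\ell$; $[2134]_h$ if $w(j)<w(i)<w(k)<w(\ell)$ for some $i<j<k<\ell\le h(k)$ with $k\le h(i)<\ell$; $[1423]_h$ if $w(i)<w(k)<w(\ell)<w(j)$ for some $i<j<k<\ell\le h(j)$ with $k\le h(i)<\ell$; $[2314]_h$ if $w(k)<w(i)<w(j)<w(\ell)$ for some $i<j<k<\ell\le h(j)$ with $k\le h(i)<\ell$. Further, for some $i<j<k\le h(i)<\ell\le h(j)<m\le h(k)$: $w$ contains $[25314]_h$ if $w(\ell)<w(i)<w(k)<w(m)<w(j)$; $[24315]_h$ if $w(\ell)<w(i)<w(k)<w(j)<w(m)$; $[14325]_h$ if $w(i)<w(\ell)<w(k)<w(j)<w(m)$; $[15324]_h$ if $w(i)<w(\ell)<w(k)<w(m)<w(j)$. *)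

theory Defs
  imports "HOL-Combinatorics.Permutations" "Graph_Theory.Graph_Theory"
begin

(* A permutation of [n] is a function u with "u permutes {1..n}"; its one-line notation is
   u 1, ..., u n.  Functions h on [n] are functions on nat, of which only the values on
   {1..n} matter. *)

definition hessenberg_function :: "nat \<Rightarrow> (nat \<Rightarrow> nat) \<Rightarrow> bool" where
  "hessenberg_function n h \<longleftrightarrow>
     h \<in> {1..n} \<rightarrow> {1..n} \<and> mono_on {1..n} h \<and> (\<forall>i\<in>{1..n}. i \<le> h i)"

definition swap_positions :: "(nat \<Rightarrow> nat) \<Rightarrow> nat \<Rightarrow> nat \<Rightarrow> nat \<Rightarrow> nat" where
  "swap_positions u i j = u \<circ> transpose i j"

definition inversion_set :: "nat \<Rightarrow> (nat \<Rightarrow> nat) \<Rightarrow> (nat \<times> nat) set" where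
  "inversion_set n u = {(i, j). 1 \<le> i \<and> i < j \<and> j \<le> n \<and> u j < u i}"

definition bruhat_step :: "nat \<Rightarrow> (nat \<Rightarrow> nat) \<Rightarrow> (nat \<Rightarrow> nat) \<Rightarrow> bool" where
  "bruhat_step n u v \<longleftrightarrow>
     (\<exists>i j. 1 \<le> i \<and> i < j \<and> j \<le> n \<and> v = swap_positions u i j \<and>
            card (inversion_set n u) < card (inversion_set n v))"

definition bruhat_le :: "nat \<Rightarrow> (nat \<Rightarrow> nat) \<Rightarrow> (nat \<Rightarrow> nat) \<Rightarrow> bool" where
  "bruhat_le n = (bruhat_step n)\<^sup>*\<^sup>*"

definition longest_perm :: "nat \<Rightarrow> nat \<Rightarrow> nat" where
  "longest_perm n i = (if i \<in> {1..n} then n + 1 - i else i)"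

definition bruhat_interval :: "nat \<Rightarrow> (nat \<Rightarrow> nat) \<Rightarrow> (nat \<Rightarrow> nat) \<Rightarrow> (nat \<Rightarrow> nat) set" where
  "bruhat_interval n v v' = {u. u permutes {1..n} \<and> bruhat_le n v u \<and> bruhat_le n u v'}"

definition generator :: "nat \<Rightarrow> (nat \<Rightarrow> nat) \<Rightarrow> (nat \<Rightarrow> nat) \<Rightarrow> bool" where
  "generator n h g \<longleftrightarrow>
     g permutes {1..n} \<and> (\<forall>i\<in>{1..n}. g i \<le> n - 1 \<longrightarrow> inv g (g i + 1) \<le> h i)"

(* Well defined: for a Hessenberg function h and a permutation w of [n],
   exactly one generator satisfies the condition. *)
definition corresponding_generator :: "nat \<Rightarrow> (nat \<Rightarrow> nat) \<Rightarrow> (nat \<Rightarrow> nat) \<Rightarrow> nat \<Rightarrow> nat" where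
  "corresponding_generator n h w =
     (THE g. generator n h g \<and>
             (\<forall>i j. 1 \<le> i \<and> i < j \<and> j \<le> n \<and> j \<le> h i \<longrightarrow> (g i < g j \<longleftrightarrow> w i < w j)))"

(* An undirected graph is a symmetric digraph: the edge {u, v} is the pair of arcs
   (u, v), (v, u).  The arc set below is symmetric, since swapping twice gives back u;
   the lemma pair_graph_hess_graph confirms that this is a finite simple graph. *)
definition hess_graph :: "nat \<Rightarrow> (nat \<Rightarrow> nat) \<Rightarrow> (nat \<Rightarrow> nat) pair_pre_digraph" where
  "hess_graph n h =
     \<lparr> pverts = {u. u permutes {1..n}},
       parcs = {(u, swap_positions u i j) | u i j.
                  u permutes {1..n} \<and> 1 \<le> i \<and> i < j \<and> j \<le> n \<and> j \<le> h i} \<rparr>"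

definition fixed_points :: "nat \<Rightarrow> (nat \<Rightarrow> nat) \<Rightarrow> (nat \<Rightarrow> nat) \<Rightarrow> (nat \<Rightarrow> nat) set" where
  "fixed_points n w h =
     (let g = corresponding_generator n h w
      in (\<lambda>u. w \<circ> inv g \<circ> u) ` bruhat_interval n g (longest_perm n))"

definition hess_schubert_graph ::
  "nat \<Rightarrow> (nat \<Rightarrow> nat) \<Rightarrow> (nat \<Rightarrow> nat) \<Rightarrow> (nat \<Rightarrow> nat, (nat \<Rightarrow> nat) \<times> (nat \<Rightarrow> nat)) pre_digraph"
where
  "hess_schubert_graph n w h = with_proj (hess_graph n h) \<restriction> fixed_points n w h"

(* In a symmetric digraph without loops or multiple arcs, the out-degree of a vertex is its
   degree in the underlying undirected graph. *)
definition regular_graph :: "('a, 'b) pre_digraph \<Rightarrow> bool" where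
  "regular_graph G \<longleftrightarrow> (\<forall>u\<in>verts G. \<forall>v\<in>verts G. out_degree G u = out_degree G v)"

definition contains_2143 :: "nat \<Rightarrow> (nat \<Rightarrow> nat) \<Rightarrow> (nat \<Rightarrow> nat) \<Rightarrow> bool" where
  "contains_2143 n h w \<longleftrightarrow>
     (\<exists>i j k l. 1 \<le> i \<and> i < j \<and> j < k \<and> k < l \<and> l \<le> n \<and>
        l \<le> h i \<and>
        w j < w i \<and> w i < w l \<and> w l < w k)"

definition contains_1324 :: "nat \<Rightarrow> (nat \<Rightarrow> nat) \<Rightarrow> (nat \<Rightarrow> nat) \<Rightarrow> bool" where
  "contains_1324 n h w \<longleftrightarrow>
     (\<exists>i j k l. 1 \<le> i \<and> i < j \<and> j < k \<and> k < l \<and> l \<le> n \<and>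
        l \<le> h j \<and> k \<le> h i \<and>
        w i < w k \<and> w k < w j \<and> w j < w l)"

definition contains_1243 :: "nat \<Rightarrow> (nat \<Rightarrow> nat) \<Rightarrow> (nat \<Rightarrow> nat) \<Rightarrow> bool" where
  "contains_1243 n h w \<longleftrightarrow>
     (\<exists>i j k l. 1 \<le> i \<and> i < j \<and> j < k \<and> k < l \<and> l \<le> n \<and>
        l \<le> h j \<and> j \<le> h i \<and> h i < l \<and>
        w i < w j \<and> w j < w l \<and> w l < w k)"

definition contains_2134 :: "nat \<Rightarrow> (nat \<Rightarrow> nat) \<Rightarrow> (nat \<Rightarrow> nat) \<Rightarrow> bool" where
  "contains_2134 n h w \<longleftrightarrow>
     (\<exists>i j k l. 1 \<le> i \<and> i < j \<and> j < k \<and> k < l \<and> l \<le> n \<and>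
        l \<le> h k \<and> k \<le> h i \<and> h i < l \<and>
        w j < w i \<and> w i < w k \<and> w k < w l)"

definition contains_1423 :: "nat \<Rightarrow> (nat \<Rightarrow> nat) \<Rightarrow> (nat \<Rightarrow> nat) \<Rightarrow> bool" where
  "contains_1423 n h w \<longleftrightarrow>
     (\<exists>i j k l. 1 \<le> i \<and> i < j \<and> j < k \<and> k < l \<and> l \<le> n \<and>
        l \<le> h j \<and> k \<le> h i \<and> h i < l \<and>
        w i < w k \<and> w k < w l \<and> w l < w j)"

definition contains_2314 :: "nat \<Rightarrow> (nat \<Rightarrow> nat) \<Rightarrow> (nat \<Rightarrow> nat) \<Rightarrow> bool" where
  "contains_2314 n h w \<longleftrightarrow>
     (\<exists>i j k l. 1 \<le> i \<and> i < j \<and> j < k \<and> k < l \<and> l \<le> n \<and>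
        l \<le> h j \<and> k \<le> h i \<and> h i < l \<and>
        w k < w i \<and> w i < w j \<and> w j < w l)"

definition admissible5 ::
  "nat \<Rightarrow> (nat \<Rightarrow> nat) \<Rightarrow> nat \<Rightarrow> nat \<Rightarrow> nat \<Rightarrow> nat \<Rightarrow> nat \<Rightarrow> bool"
where
  "admissible5 n h i j k l m \<longleftrightarrow>
     1 \<le> i \<and> i < j \<and> j < k \<and> k \<le> h i \<and> h i < l \<and> l \<le> h j \<and> h j < m \<and> m \<le> h k \<and> m \<le> n"

definition contains_25314 :: "nat \<Rightarrow> (nat \<Rightarrow> nat) \<Rightarrow> (nat \<Rightarrow> nat) \<Rightarrow> bool" where
  "contains_25314 n h w \<longleftrightarrow>
     (\<exists>i j k l m. admissible5 n h i j k l m \<and>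
        w l < w i \<and> w i < w k \<and> w k < w m \<and> w m < w j)"

definition contains_24315 :: "nat \<Rightarrow> (nat \<Rightarrow> nat) \<Rightarrow> (nat \<Rightarrow> nat) \<Rightarrow> bool" where
  "contains_24315 n h w \<longleftrightarrow>
     (\<exists>i j k l m. admissible5 n h i j k l m \<and>
        w l < w i \<and> w i < w k \<and> w k < w j \<and> w j < w m)"

definition contains_14325 :: "nat \<Rightarrow> (nat \<Rightarrow> nat) \<Rightarrow> (nat \<Rightarrow> nat) \<Rightarrow> bool" where
  "contains_14325 n h w \<longleftrightarrow>
     (\<exists>i j k l m. admissible5 n h i j k l m \<and>
        w i < w l \<and> w l < w k \<and> w k < w j \<and> w j < w m)"

definition contains_15324 :: "nat \<Rightarrow> (nat \<Rightarrow> nat) \<Rightarrow> (nat \<Rightarrow> nat) \<Rightarrow> bool" where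
  "contains_15324 n h w \<longleftrightarrow>
     (\<exists>i j k l m. admissible5 n h i j k l m \<and>
        w i < w l \<and> w l < w k \<and> w k < w m \<and> w m < w j)"

lemma swap_positions_permutes:
  assumes "u permutes {1..n}" "1 \<le> i" "i < j" "j \<le> n"
  shows "swap_positions u i j permutes {1..n}"
  unfolding swap_positions_def
  using assms by (intro permutes_compose permutes_swap_id) auto

lemma pair_graph_hess_graph: "pair_graph (hess_graph n h)"
proof
  show wf1: "fst e \<in> pverts (hess_graph n h)" if "e \<in> parcs (hess_graph n h)" for e
    using that by (auto simp: hess_graph_def)
  show wf2: "snd e \<in> pverts (hess_graph n h)" if "e \<in> parcs (hess_graph n h)" for e
    using that by (auto simp: hess_graph_def intro: swap_positions_permutes[simplified])
  show fin: "finite (pverts (hess_graph n h))"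
    by (simp add: hess_graph_def finite_permutations)
  have "parcs (hess_graph n h) \<subseteq> pverts (hess_graph n h) \<times> pverts (hess_graph n h)"
    using wf1 wf2 by (auto simp: mem_Times_iff)
  then show "finite (parcs (hess_graph n h))"
    using fin finite_subset by blast
  show "fst e \<noteq> snd e" if arc: "e \<in> parcs (hess_graph n h)" for e
  proof
    assume eq: "fst e = snd e"
    obtain u i j where u: "u permutes {1..n}" "i < j" "e = (u, swap_positions u i j)"
      using arc by (auto simp: hess_graph_def)
    have "u i = u j"
      using eq u(3) by (metis comp_apply fst_conv snd_conv swap_positions_def transpose_apply_first)
    then show False
      using u(1,2) permutes_inj[OF u(1)] by (auto dest: injD)
  qed
  have "(v, u) \<in> parcs (hess_graph n h)" if arc: "(u, v) \<in> parcs (hess_graph n h)" for u v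
  proof -
    obtain i j where ij: "u permutes {1..n}" "1 \<le> i" "i < j" "j \<le> n" "j \<le> h i"
        "v = swap_positions u i j"
      using arc by (auto simp: hess_graph_def)
    have "u = swap_positions v i j"
      using ij(6) by (simp add: swap_positions_def comp_assoc)
    moreover have "v permutes {1..n}"
      using ij swap_positions_permutes by blast
    ultimately show ?thesis
      using ij(2-5) by (auto simp: hess_graph_def)
  qed
  then show "symmetric (with_proj (hess_graph n h))"
    by (auto simp: symmetric_def sym_def)
qed

end

theory Submission
  imports Defs
begin

text \<open>
  Left multiplication identifies the graph of \<open>w\<close> with that of its generator \<open>g\<close>, and the patterns only
  involve comparisons that \<open>w\<close> and \<open>g\<close> share, so assume that \<open>w\<close> is a generator. The degree increases
  weakly along Bruhat steps, hence the graph is regular iff \<open>w\<close> and the longest element have equal degrees.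
  Every \<open>u\<close> above \<open>w\<close> lies in the band between the prefix minima and the suffix maxima of \<open>w\<close>. The
  number of edges at \<open>u\<close> that stay inside the band also increases weakly, is at least the degree of \<open>u\<close>,
  and equals it at the longest element. If the degrees agree, this number is therefore constant on the
  interval, whereas each pattern yields either a band edge at \<open>w\<close> that is not an edge, or a Bruhat step that
  increases the number strictly. Conversely, in a generator comparable positions are joined by increasing paths
  of edges; with their help avoidance makes all band edges at \<open>w\<close> edges and forces the number to be the
  same at \<open>w\<close> and at the longest element, by counting pairs that leave the band row by row and column by column.
\<close>

section \<open>Bruhat order and the rank function\<close>

text \<open>Whether a transposition of \<open>u\<close> stays in the interval depends on its whole
  rank matrix, whereas the band condition only bounds the two swapped entries; so its violations can
  be counted. The two conditions agree at the longest element because its rank matrix is maximal: a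
  swap costs one on a rectangle, and a band edge guarantees exactly this slack.

  The obstacle is that \<open>pmin\<close> and \<open>smax\<close> may be attained at remote
  positions, while a pattern bounds the distances between its letters. The bridge consists of
  statements with unrestricted distances: wide 1324 patterns, left gaps and right gaps. Equal
  degrees exclude them directly; in a generator, a violation is pulled together into a genuine
  pattern at the place where an increasing path jumps over a given position. Together with 2143 they
  feed the final count.

  Most arguments come in mirror pairs, since reversing both positions and values preserves Bruhat
  order and exchanges \<open>pmin\<close> with \<open>smax\<close>.\<close>

lemma transpose_permutes:
  assumes "u permutes {1..n::nat}" "1 \<le> i" "i < j" "j \<le> n"
  shows "(u \<circ> transpose i j) permutes {1..n}"
  using swap_positions_permutes[OF assms] by (simp add: swap_positions_def)

lemma finite_inversion_set: "finite (inversion_set n u)"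
  by (rule finite_subset[of _ "{1..n} \<times> {1..n}"]) (auto simp: inversion_set_def)

lemma card_inversion_set_less:
  assumes "1 \<le> i" "i < j" "j \<le> n" "u i < u j"
  shows "card (inversion_set n u) < card (inversion_set n (u \<circ> transpose i j))"
proof -
  let ?t = "transpose i j" and ?v = "u \<circ> transpose i j"
  \<comment> \<open>\<open>f\<close> applies the transposition to a pair unless this would reverse
    the order of its positions. It is its own inverse on ordered pairs and maps no inversion of
    \<open>u\<close> to \<open>(i, j)\<close>, hence the strict increase.\<close>
  define f where "f = (\<lambda>(p, q). if ?t p < ?t q then (?t p, ?t q) else (p, q))"
  have invol: "f (f (p, q)) = (p, q)" if "p < q" for p q
    using that by (simp add: f_def)
  have "inj_on f (inversion_set n u)"
  proof (rule inj_onI)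
    fix x y assume xy: "x \<in> inversion_set n u" "y \<in> inversion_set n u" "f x = f y"
    then have "fst x < snd x" "fst y < snd y" by (auto simp: inversion_set_def)
    then have "f (f x) = x" "f (f y) = y"
      using invol[of "fst x" "snd x"] invol[of "fst y" "snd y"] by simp_all
    then show "x = y" using xy by metis
  qed
  moreover have "f ` inversion_set n u \<subseteq> inversion_set n ?v - {(i, j)}"
  proof
    fix x assume "x \<in> f ` inversion_set n u"
    then obtain p q where pq: "1 \<le> p" "p < q" "q \<le> n" "u q < u p" "x = f (p, q)"
      by (auto simp: inversion_set_def)
    show "x \<in> inversion_set n ?v - {(i, j)}"
    proof (cases "?t p < ?t q")
      case True
      have "1 \<le> ?t p" "?t q \<le> n"
        using pq assms by (auto simp: transpose_def)
      moreover have "(?t p, ?t q) \<noteq> (i, j)"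
        using pq(2) assms(2) by (auto simp: transpose_eq_iff)
      ultimately show ?thesis
        using True pq by (auto simp: f_def inversion_set_def)
    next
      case False
      then have "p = i \<and> q < j \<or> i < p \<and> q = j \<or> p = i \<and> q = j"
        using pq(2) assms(2) by (auto simp: transpose_def split: if_splits)
      then show ?thesis
        using False pq assms by (auto simp: f_def inversion_set_def transpose_def)
    qed
  qed
  ultimately have "card (inversion_set n u) \<le> card (inversion_set n ?v - {(i, j)})"
    by (rule card_inj_on_le) (rule finite_Diff[OF finite_inversion_set])
  also have "\<dots> < card (inversion_set n ?v)"
    using assms by (intro card_Diff1_less finite_inversion_set) (auto simp: inversion_set_def)
  finally show ?thesis .
qed

lemma bruhat_step_iff:
  assumes "u permutes {1..n}"
  shows "bruhat_step n u v \<longleftrightarrow>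
    (\<exists>i j. 1 \<le> i \<and> i < j \<and> j \<le> n \<and> u i < u j \<and> v = u \<circ> transpose i j)"
proof -
  have "card (inversion_set n u) < card (inversion_set n (u \<circ> transpose i j)) \<longleftrightarrow> u i < u j"
    if "1 \<le> i" "i < j" "j \<le> n" for i j
  proof -
    have "u i \<noteq> u j" using that permutes_inj[OF assms] by (auto dest: injD)
    moreover have "card (inversion_set n (u \<circ> transpose i j)) < card (inversion_set n u)" if "u j < u i"
    proof -
      have "(u \<circ> transpose i j) i < (u \<circ> transpose i j) j" using that by simp
      from card_inversion_set_less[OF \<open>1 \<le> i\<close> \<open>i < j\<close> \<open>j \<le> n\<close> this]
      moreover have "u \<circ> transpose i j \<circ> transpose i j = u" by (simp add: fun_eq_iff)
      ultimately show ?thesis by (simp only:)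
    qed
    ultimately show ?thesis
      using card_inversion_set_less[OF that] by (metis less_asym' linorder_neqE_nat)
  qed
  then show ?thesis
    unfolding bruhat_step_def swap_positions_def by metis
qed

lemma bruhat_le_induct [consumes 2, case_names refl step]:
  assumes "bruhat_le n u v" "u permutes {1..n}"
    and "P u"
    and "\<And>x i j. bruhat_le n u x \<Longrightarrow> x permutes {1..n} \<Longrightarrow> 1 \<le> i \<Longrightarrow> i < j \<Longrightarrow> j \<le> n \<Longrightarrow> x i < x j
      \<Longrightarrow> bruhat_le n (x \<circ> transpose i j) v \<Longrightarrow> P x \<Longrightarrow> P (x \<circ> transpose i j)"
  shows "P v"
proof -
  have "bruhat_le n x v \<longrightarrow> x permutes {1..n} \<and> P x" if "bruhat_le n u x" for x
    using that[unfolded bruhat_le_def]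
  proof (induction rule: rtranclp_induct)
    case base
    then show ?case using assms by simp
  next
    case (step x y)
    show ?case
    proof
      assume y: "bruhat_le n y v"
      then have "bruhat_le n x v"
        using step(2) unfolding bruhat_le_def by (metis converse_rtranclp_into_rtranclp)
      then have x: "x permutes {1..n}" "P x" using step.IH by auto
      then obtain i j where ij: "1 \<le> i" "i < j" "j \<le> n" "x i < x j" "y = x \<circ> transpose i j"
        using step(2) bruhat_step_iff by blast
      have "P y"
        using assms(4)[OF _ x(1) ij(1-4)] y x(2) step(1) unfolding ij(5) bruhat_le_def by blast
      then show "y permutes {1..n} \<and> P y"
        using transpose_permutes[OF x(1) ij(1-3)] ij(5) by simp
    qed
  qed
  then show ?thesis using assms(1) unfolding bruhat_le_def by blast
qed

text \<open>The rank matrix of the tableau criterion. Large entries are counted so that going up in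
  Bruhat order increases the matrix entrywise.\<close>

definition rank_count :: "(nat \<Rightarrow> nat) \<Rightarrow> nat \<Rightarrow> nat \<Rightarrow> nat" where
  "rank_count u p q = card {a \<in> {1..p}. q \<le> u a}"

lemma rank_count_transpose:
  assumes "1 \<le> i" "i < j" "u i < u j"
  shows "rank_count (u \<circ> transpose i j) p q =
    rank_count u p q + (if i \<le> p \<and> p < j \<and> u i < q \<and> q \<le> u j then 1 else 0)"
proof -
  let ?t = "transpose i j"
  let ?U = "{a \<in> {1..p}. q \<le> u a}" and ?V = "{a \<in> {1..p}. q \<le> (u \<circ> ?t) a}"
  consider "p < i" | "j \<le> p" | "i \<le> p" "p < j" by linarith
  then show ?thesis
  proof cases
    case 1
    then have "?V = ?U" using assms by (auto simp: transpose_def)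
    then show ?thesis using 1 by (simp add: rank_count_def)
  next
    case 2
    have "?V = ?t ` ?U"
    proof
      show "?t ` ?U \<subseteq> ?V" using 2 assms by (auto simp: transpose_def)
      show "?V \<subseteq> ?t ` ?U"
      proof
        fix a assume "a \<in> ?V"
        then have "?t a \<in> ?U" using 2 assms by (auto simp: transpose_def split: if_splits)
        then show "a \<in> ?t ` ?U" by (metis image_eqI transpose_involutory)
      qed
    qed
    then have "card ?V = card ?U" by (simp add: card_image)
    then show ?thesis using 2 by (simp add: rank_count_def)
  next
    case 3
    have "?V - {i} = ?U - {i}" using 3 assms by (auto simp: transpose_def)
    moreover have "i \<in> ?V \<longleftrightarrow> q \<le> u j" "i \<in> ?U \<longleftrightarrow> q \<le> u i" using 3 assms by auto
    moreover have "card X = card (X - {i}) + (if i \<in> X then 1 else 0)" if "finite X" for X :: "nat set"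
      using that card_Suc_Diff1[of X i] by auto
    from this[of ?U] this[of ?V] have
      "card ?U = card (?U - {i}) + (if i \<in> ?U then 1 else 0)"
      "card ?V = card (?V - {i}) + (if i \<in> ?V then 1 else 0)" by simp_all
    ultimately show ?thesis
      using 3 assms unfolding rank_count_def by auto
  qed
qed

text \<open>The hard half of the tableau criterion. At the first position where \<open>w\<close> and
  \<open>v\<close> differ, a Bruhat step is made that does not exceed the ranks of \<open>v\<close>;
  the number of inversions bounds the recursion.\<close>

lemma rank_count_le_bruhat:
  assumes "w permutes {1..n}" "v permutes {1..n}"
    and "\<And>p q. p \<le> n \<Longrightarrow> rank_count w p q \<le> rank_count v p q"
  shows "bruhat_le n w v"
  using assms(1,3)
proof (induction "n * n - card (inversion_set n w)" arbitrary: w rule: less_induct)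
  case less
  note w = less.prems(1) and le = less.prems(2)
  show ?case
  proof (cases "w = v")
    case True
    then show ?thesis by (simp add: bruhat_le_def)
  next
    case False
    have inj: "inj w" "inj v" using w assms(2) permutes_inj by auto
    define i where "i = (LEAST i. w i \<noteq> v i)"
    have i: "w i \<noteq> v i" and before: "\<And>a. a < i \<Longrightarrow> w a = v a"
      using LeastI_ex[of "\<lambda>i. w i \<noteq> v i"] not_less_Least[of _ "\<lambda>i. w i \<noteq> v i"] False
      unfolding i_def by blast+
    have i_in: "i \<in> {1..n}"
      using i w assms(2) by (metis permutes_not_in)
    have vi_in: "v i \<in> {1..n}" using assms(2) i_in permutes_in_image by metis
    have split: "rank_count x i q = card {a \<in> {1..<i}. q \<le> x a} + (if q \<le> x i then 1 else 0)" for x q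
    proof -
      have "{a \<in> {1..i}. q \<le> x a} = {a \<in> {1..<i}. q \<le> x a} \<union> (if q \<le> x i then {i} else {})"
        using i_in le_eq_less_or_eq by auto
      then show ?thesis unfolding rank_count_def by (simp add: card_insert_if)
    qed
    have "{a \<in> {1..<i}. w i \<le> w a} = {a \<in> {1..<i}. w i \<le> v a}" using before by auto
    then have "w i \<le> v i"
      using le[of i "w i"] i_in split[of w "w i"] split[of v "w i"] by (auto split: if_splits)
    then have wv: "w i < v i" using i by simp
    \<comment> \<open>The first later position with an entry in the window above \<open>w i\<close>
      and up to \<open>v i\<close> becomes \<open>j\<close>, so that \<open>w\<close> has no entry
      of the window strictly between \<open>i\<close> and \<open>j\<close>.\<close>
    define J where "J = {j. i < j \<and> w i < w j \<and> w j \<le> v i}"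
    have "inv w (v i) \<in> J"
    proof -
      have eq: "w (inv w (v i)) = v i" using permutes_inverses[OF w] by simp
      have "\<not> inv w (v i) < i" using before eq inj by (metis injD less_irrefl)
      moreover have "inv w (v i) \<noteq> i" using eq i by metis
      ultimately show ?thesis unfolding J_def using eq wv by simp
    qed
    define j where "j = (LEAST j. j \<in> J)"
    have "j \<in> J" and gap: "\<And>a. a < j \<Longrightarrow> a \<notin> J"
      using LeastI[of "\<lambda>j. j \<in> J", OF \<open>inv w (v i) \<in> J\<close>] not_less_Least[of _ "\<lambda>j. j \<in> J"]
      unfolding j_def by blast+
    then have j: "i < j" "w i < w j" "w j \<le> v i" by (simp_all add: J_def)
    have jn: "j \<le> n"
    proof (rule ccontr)
      assume "\<not> j \<le> n"
      then have "w j = j" using w by (simp add: permutes_def)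
      then show False using \<open>\<not> j \<le> n\<close> j vi_in by simp
    qed
    let ?w = "w \<circ> transpose i j"
    have le': "rank_count ?w p q \<le> rank_count v p q" if "p \<le> n" for p q
    proof (cases "i \<le> p \<and> p < j \<and> w i < q \<and> q \<le> w j")
      case True
      \<comment> \<open>Where the swap adds one, a strict inequality is needed. Above
        \<open>v i\<close> the assumption suffices; from \<open>q\<close> to \<open>v i\<close>, the
        entries of \<open>w\<close> up to position \<open>p\<close> all sit before \<open>i\<close>,
        where \<open>w\<close> agrees with \<open>v\<close>, and \<open>v\<close> has one more at
        \<open>i\<close>.\<close>
      let ?r = "Suc (v i)"
      have diff: "rank_count x p q = rank_count x p ?r + card {a \<in> {1..p}. q \<le> x a \<and> x a \<le> v i}" for x
      proof -
        have "{a \<in> {1..p}. q \<le> x a} = {a \<in> {1..p}. ?r \<le> x a} \<union> {a \<in> {1..p}. q \<le> x a \<and> x a \<le> v i}"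
          using True j by auto
        then show ?thesis unfolding rank_count_def
          by (simp only:) (subst card_Un_disjoint, auto)
      qed
      have "{a \<in> {1..p}. q \<le> w a \<and> w a \<le> v i} \<subseteq> {a \<in> {1..p}. q \<le> v a \<and> v a \<le> v i} - {i}"
      proof
        fix a assume a: "a \<in> {a \<in> {1..p}. q \<le> w a \<and> w a \<le> v i}"
        then have "\<not> i < a" using gap[of a] True unfolding J_def by auto
        moreover have "a \<noteq> i" using a True by auto
        ultimately show "a \<in> {a \<in> {1..p}. q \<le> v a \<and> v a \<le> v i} - {i}"
          using a before[of a] by auto
      qed
      then have "card {a \<in> {1..p}. q \<le> w a \<and> w a \<le> v i} \<le> card ({a \<in> {1..p}. q \<le> v a \<and> v a \<le> v i} - {i})"
        by (intro card_mono) auto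
      also have "\<dots> < card {a \<in> {1..p}. q \<le> v a \<and> v a \<le> v i}"
        using True i_in j by (intro card_Diff1_less) auto
      finally have "rank_count w p q < rank_count v p q"
        using diff[of w] diff[of v] le[OF that, of ?r] by linarith
      then show ?thesis
        using rank_count_transpose[of i j w p q] i_in j by simp
    next
      case False
      then show ?thesis
        using rank_count_transpose[of i j w p q] i_in j le[OF that, of q] by auto
    qed
    have w': "?w permutes {1..n}" using transpose_permutes w i_in j jn by auto
    have less_inv: "card (inversion_set n w) < card (inversion_set n ?w)"
      using card_inversion_set_less i_in j jn by auto
    have "card (inversion_set n ?w) \<le> card ({1..n} \<times> {1..n})"
      by (rule card_mono) (auto simp: inversion_set_def)
    then have "n * n - card (inversion_set n ?w) < n * n - card (inversion_set n w)"
      using less_inv by simp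
    then have "bruhat_le n ?w v"
      using less.hyps[OF _ w'] le' by blast
    moreover have "bruhat_step n w ?w"
      using bruhat_step_iff[OF w] i_in j jn by auto
    ultimately show ?thesis
      unfolding bruhat_le_def by (metis converse_rtranclp_into_rtranclp)
  qed
qed

lemma bruhat_le_iff_rank_count:
  assumes "u permutes {1..n}" "v permutes {1..n}"
  shows "bruhat_le n u v \<longleftrightarrow> (\<forall>p\<le>n. \<forall>q. rank_count u p q \<le> rank_count v p q)"
proof
  assume "bruhat_le n u v"
  then show "\<forall>p\<le>n. \<forall>q. rank_count u p q \<le> rank_count v p q"
    using assms(1)
  proof (induction rule: bruhat_le_induct)
    case (step x i j)
    then show ?case
      by (simp only: rank_count_transpose) (auto intro: trans_le_add1 le_SucI)
  qed simp
qed (use assms rank_count_le_bruhat in blast)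

lemma bruhat_le_trans: "bruhat_le n u v \<Longrightarrow> bruhat_le n v x \<Longrightarrow> bruhat_le n u x"
  unfolding bruhat_le_def by (rule rtranclp_trans)

lemma bruhat_le_transpose:
  assumes "u permutes {1..n}" "1 \<le> i" "i < j" "j \<le> n" "u i < u j"
  shows "bruhat_le n u (u \<circ> transpose i j)"
  unfolding bruhat_le_def using bruhat_step_iff assms by blast

lemma longest_perm_permutes: "longest_perm n permutes {1..n}"
  by (rule bij_imp_permutes, rule bij_betwI[of _ _ _ "longest_perm n"]) (auto simp: longest_perm_def)

lemma rank_count_longest_perm:
  assumes "p \<le> n"
  shows "rank_count (longest_perm n) p q = min p (n + 1 - q)"
proof -
  have "{a \<in> {1..p}. q \<le> longest_perm n a} = {1..min p (n + 1 - q)}"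
    using assms by (auto simp: longest_perm_def)
  then show ?thesis by (simp add: rank_count_def)
qed

lemma rank_count_bounds:
  assumes "u permutes {1..n}" "p \<le> n"
  shows "rank_count u p q \<le> min p (n + 1 - q)"
proof -
  have "card {a \<in> {1..p}. q \<le> u a} \<le> card {1..p}" by (rule card_mono) auto
  moreover have "card {a \<in> {1..p}. q \<le> u a} \<le> card {q..n}"
  proof (rule card_inj_on_le)
    show "inj_on u {a \<in> {1..p}. q \<le> u a}"
      by (rule permutes_inj_on[OF assms(1)])
    show "u ` {a \<in> {1..p}. q \<le> u a} \<subseteq> {q..n}"
      using permutes_in_image[OF assms(1)] assms(2) by fastforce
  qed simp
  ultimately show ?thesis by (simp add: rank_count_def)
qed

lemma bruhat_le_longest_perm:
  assumes "u permutes {1..n}"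
  shows "bruhat_le n u (longest_perm n)"
  using rank_count_le_bruhat[OF assms longest_perm_permutes]
    rank_count_bounds[OF assms] rank_count_longest_perm by metis

section \<open>Degrees in an upper Bruhat interval\<close>

text \<open>The counting argument shared by edges and band pairs. For \<open>c\<close> outside the
  segment from \<open>i\<close> to \<open>j\<close>, the pairs joining \<open>c\<close> to
  \<open>i\<close> and to \<open>j\<close> form a block of two. If \<open>D\<close> meets the block,
  \<open>D'\<close> contains its preferred member, and both if \<open>D\<close> contains both; so
  blocks map injectively. A block missed by \<open>D\<close> whose preferred member is in
  \<open>D'\<close> gives strictness.\<close>

lemma card_pairs_transpose_mono:
  fixes D D' :: "('a::linorder \<times> 'a) set"
  assumes "finite D'" "i < j"
    and other: "\<And>p q. (p, q) \<in> D \<Longrightarrow> \<not> (p < i \<and> q \<in> {i, j}) \<Longrightarrow> \<not> (p \<in> {i, j} \<and> j < q) \<Longrightarrow> (p, q) \<in> D'"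
    and left: "\<And>c. c < i \<Longrightarrow> (c, i) \<in> D \<or> (c, j) \<in> D \<Longrightarrow> (c, i) \<in> D'"
      "\<And>c. c < i \<Longrightarrow> (c, i) \<in> D \<Longrightarrow> (c, j) \<in> D \<Longrightarrow> (c, j) \<in> D'"
    and right: "\<And>c. j < c \<Longrightarrow> (i, c) \<in> D \<or> (j, c) \<in> D \<Longrightarrow> (j, c) \<in> D'"
      "\<And>c. j < c \<Longrightarrow> (i, c) \<in> D \<Longrightarrow> (j, c) \<in> D \<Longrightarrow> (i, c) \<in> D'"
  shows "card D \<le> card D'"
    and "c < i \<Longrightarrow> (c, i) \<in> D' \<Longrightarrow> (c, i) \<notin> D \<Longrightarrow> (c, j) \<notin> D \<Longrightarrow> card D < card D'"
    and "j < c \<Longrightarrow> (j, c) \<in> D' \<Longrightarrow> (i, c) \<notin> D \<Longrightarrow> (j, c) \<notin> D \<Longrightarrow> card D < card D'"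
proof -
  \<comment> \<open>Only the other member of a block moves, and only if the preferred place is
    free.\<close>
  define f where "f = (\<lambda>(p, q). if p < i \<and> q = j \<and> (p, i) \<notin> D then (p, i)
    else if p = i \<and> j < q \<and> (j, q) \<notin> D then (j, q) else (p, q))"
  have inj: "inj_on f D"
    unfolding inj_on_def f_def using \<open>i < j\<close> by (auto split: if_splits)
  have sub: "f ` D \<subseteq> D'"
  proof
    fix x assume "x \<in> f ` D"
    then obtain p q where pq: "(p, q) \<in> D" "x = f (p, q)" by auto
    show "x \<in> D'"
      using pq other[of p q] left[of p] right[of q] \<open>i < j\<close> by (auto simp: f_def)
  qed
  show "card D \<le> card D'" using inj sub \<open>finite D'\<close> by (rule card_inj_on_le)
  have strict: "card D < card D'" if "x \<in> D'" "x \<notin> f ` D" for x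
  proof -
    have "card D \<le> card (D' - {x})"
      by (rule card_inj_on_le[OF inj]) (use sub that \<open>finite D'\<close> in auto)
    also have "\<dots> < card D'" using that \<open>finite D'\<close> by (intro card_Diff1_less)
    finally show ?thesis .
  qed
  show "card D < card D'" if "c < i" "(c, i) \<in> D'" "(c, i) \<notin> D" "(c, j) \<notin> D"
    using that \<open>i < j\<close> by (intro strict[of "(c, i)"]) (auto simp: f_def split: if_splits)
  show "card D < card D'" if "j < c" "(j, c) \<in> D'" "(i, c) \<notin> D" "(j, c) \<notin> D"
    using that \<open>i < j\<close> by (intro strict[of "(j, c)"]) (auto simp: f_def split: if_splits)
qed

text \<open>\<open>A\<close> abstracts adjacency of positions. Closure under shrinking of intervals
  is what monotonicity of a Hessenberg function provides, in a form invariant under reversal of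
  positions.\<close>

locale hess_perm =
  fixes n :: nat and A :: "nat \<Rightarrow> nat \<Rightarrow> bool" and w :: "nat \<Rightarrow> nat"
  assumes A_range: "A i j \<Longrightarrow> 1 \<le> i \<and> i < j \<and> j \<le> n"
    and A_sub: "A i j \<Longrightarrow> i \<le> i' \<Longrightarrow> i' < j' \<Longrightarrow> j' \<le> j \<Longrightarrow> A i' j'"
    and w: "w permutes {1..n}"
begin

section \<open>The interval above \<open>w\<close>, its band, and the two edge counts\<close>

definition above :: "(nat \<Rightarrow> nat) \<Rightarrow> bool" where
  "above u \<longleftrightarrow> u permutes {1..n} \<and> bruhat_le n w u"

definition pmin :: "nat \<Rightarrow> nat" where "pmin p = Min (w ` {1..p})"

definition smax :: "nat \<Rightarrow> nat" where "smax q = Max (w ` {q..n})"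

definition up_pairs :: "(nat \<Rightarrow> nat) \<Rightarrow> (nat \<times> nat) set" where
  "up_pairs u = {(p, q). A p q \<and> above (u \<circ> transpose p q)}"

text \<open>A swap puts \<open>u p\<close> at \<open>q\<close> and \<open>u q\<close> at
  \<open>p\<close>. For \<open>u\<close> above \<open>w\<close> these two inequalities amount to
  staying in the band; the other two bounds follow from monotonicity of \<open>pmin\<close> and
  \<open>smax\<close>.\<close>

definition band_pairs :: "(nat \<Rightarrow> nat) \<Rightarrow> (nat \<times> nat) set" where
  "band_pairs u = {(p, q). A p q \<and> u p \<le> smax q \<and> pmin p \<le> u q}"

lemma finite_A: "finite {(p, q). A p q \<and> P p q}"
  by (rule finite_subset[of _ "{1..n} \<times> {1..n}"]) (use A_range in force)+

lemma above_w: "above w"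
  using w by (simp add: above_def bruhat_le_def)

lemma above_transpose:
  assumes "above u" "1 \<le> i" "i < j" "j \<le> n" "u i < u j"
  shows "above (u \<circ> transpose i j)"
  using assms transpose_permutes bruhat_le_transpose bruhat_le_trans unfolding above_def by blast

lemma above_transposeD:
  assumes "above y" "y i < y j" "u = y \<circ> transpose i j" "1 \<le> i" "i < j" "j \<le> n"
  shows "above u"
  using above_transpose assms by simp

lemma above_inj: "above u \<Longrightarrow> u x = u y \<longleftrightarrow> x = y"
  unfolding above_def using permutes_inj by (metis injD)

lemma above_rank: "above u \<longleftrightarrow> u permutes {1..n} \<and> (\<forall>p\<le>n. \<forall>q. rank_count w p q \<le> rank_count u p q)"
  unfolding above_def using bruhat_le_iff_rank_count w by blast

lemma pmin_le: "1 \<le> a \<Longrightarrow> a \<le> p \<Longrightarrow> pmin p \<le> w a"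
  unfolding pmin_def by simp

lemma pmin_obtain:
  assumes "1 \<le> p" obtains a where "1 \<le> a" "a \<le> p" "w a = pmin p"
proof -
  have "Min (w ` {1..p}) \<in> w ` {1..p}" using assms by (intro Min_in) auto
  then show ?thesis using that unfolding pmin_def by auto
qed

lemma pmin_antimono: "1 \<le> p \<Longrightarrow> p \<le> q \<Longrightarrow> pmin q \<le> pmin p"
  by (metis pmin_obtain pmin_le le_trans)

lemma le_smax: "q \<le> b \<Longrightarrow> b \<le> n \<Longrightarrow> w b \<le> smax q"
  unfolding smax_def by simp

lemma smax_obtain:
  assumes "q \<le> n" obtains b where "q \<le> b" "b \<le> n" "w b = smax q"
proof -
  have "Max (w ` {q..n}) \<in> w ` {q..n}" using assms by (intro Max_in) auto
  then show ?thesis using that unfolding smax_def by auto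
qed

lemma smax_antimono: "p \<le> q \<Longrightarrow> q \<le> n \<Longrightarrow> smax q \<le> smax p"
  by (metis smax_obtain le_smax le_trans)

text \<open>A Bruhat step moves the larger entry left, where \<open>smax\<close> is weakly larger,
  and the smaller entry right, where \<open>pmin\<close> is weakly smaller.\<close>

lemma above_band:
  assumes "above u" "1 \<le> a" "a \<le> n"
  shows "pmin a \<le> u a" "u a \<le> smax a"
proof -
  have "\<forall>a. 1 \<le> a \<and> a \<le> n \<longrightarrow> pmin a \<le> u a \<and> u a \<le> smax a"
    using assms(1)[unfolded above_def, THEN conjunct2] w
  proof (induction rule: bruhat_le_induct)
    case refl
    then show ?case using pmin_le le_smax by simp
  next
    case (step x i j)
    show ?case
    proof (intro allI impI)
      fix a assume a: "1 \<le> a \<and> a \<le> n"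
      have "pmin j \<le> pmin i" "smax j \<le> smax i"
        using step pmin_antimono smax_antimono by simp_all
      moreover have "pmin a \<le> x a" "x a \<le> smax a" "pmin i \<le> x i" "x j \<le> smax j"
        using step a by simp_all
      ultimately show "pmin a \<le> (x \<circ> transpose i j) a \<and> (x \<circ> transpose i j) a \<le> smax a"
        using step(6) by (auto simp: transpose_def)
    qed
  qed
  then show "pmin a \<le> u a" "u a \<le> smax a" using assms by simp_all
qed

text \<open>The two transpositions change the rank function on disjoint rectangles.\<close>

lemma above_of_two_transpositions:
  assumes "y permutes {1..n}" "1 \<le> c" "c < i" "i < j" "y c < y i" "y i < y j"
    and "above (y \<circ> transpose i j)" "above (y \<circ> transpose c i)"
  shows "above y"
  unfolding above_rank
proof (intro conjI allI impI assms(1))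
  fix p q assume "p \<le> n"
  then have "rank_count w p q \<le> rank_count (y \<circ> transpose i j) p q"
    "rank_count w p q \<le> rank_count (y \<circ> transpose c i) p q"
    using assms(7,8) unfolding above_rank by blast+
  then show "rank_count w p q \<le> rank_count y p q"
    using rank_count_transpose[of i j y p q] rank_count_transpose[of c i y p q] assms(2-6)
    by (auto split: if_splits)
qed

text \<open>Mostly the required neighbour of the new permutation arises by an increasing
  transposition from the new permutation itself or from a known neighbour of \<open>u\<close>. The
  delicate cases are an entry left of \<open>i\<close> above \<open>u j\<close>, and one right of
  \<open>j\<close> below \<open>u i\<close>.\<close>

lemma card_up_pairs_mono:
  assumes u: "above u" and ij: "1 \<le> i" "i < j" "j \<le> n" "u i < u j"
  shows "card (up_pairs u) \<le> card (up_pairs (u \<circ> transpose i j))"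
proof (rule card_pairs_transpose_mono(1)[OF _ \<open>i < j\<close>])
  let ?v = "u \<circ> transpose i j"
  have v: "above ?v" using above_transpose u ij by blast
  have perm: "?v permutes {1..n}" using v by (simp add: above_def)
  show "finite (up_pairs ?v)"
    unfolding up_pairs_def by (rule finite_A)
  show "(p, q) \<in> up_pairs ?v"
    if pq: "(p, q) \<in> up_pairs u" "\<not> (p < i \<and> q \<in> {i, j})" "\<not> (p \<in> {i, j} \<and> j < q)" for p q
  proof -
    have A: "A p q" and up: "above (u \<circ> transpose p q)" using pq by (auto simp: up_pairs_def)
    note r = A_range[OF A]
    have "above (?v \<circ> transpose p q)"
    proof -
      consider "p \<notin> {i, j}" "q \<notin> {i, j}" | "p = i" "q = j" | "p = i" "i < q" "q < j" | "i < p" "p < j" "q = j"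
        using pq r \<open>i < j\<close> by fastforce
      then show ?thesis
      proof cases
        case 1
        then show ?thesis using ij
          by (intro above_transposeD[OF up, of i j]) (auto simp: fun_eq_iff transpose_def)
      next
        case 2
        have "?v \<circ> transpose i j = u" by (simp add: fun_eq_iff)
        then show ?thesis using 2 u by simp
      next
        case 3
        then show ?thesis using ij r
          by (intro above_transposeD[OF up, of q j]) (auto simp: fun_eq_iff transpose_def)
      next
        case 4
        then show ?thesis using ij r
          by (intro above_transposeD[OF up, of i p]) (auto simp: fun_eq_iff transpose_def)
      qed
    qed
    then show ?thesis using A by (simp add: up_pairs_def)
  qed
  show "(c, i) \<in> up_pairs ?v" if c: "c < i" "(c, i) \<in> up_pairs u \<or> (c, j) \<in> up_pairs u" for c
  proof -
    have A: "A c i" using c A_sub[of c j c i] ij by (auto simp: up_pairs_def)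
    note r = A_range[OF A]
    have "above (?v \<circ> transpose c i)"
    proof (cases "(c, i) \<in> up_pairs u")
      case True
      then have up: "above (u \<circ> transpose c i)" by (simp add: up_pairs_def)
      show ?thesis using ij r c
        by (intro above_transposeD[OF up, of c j]) (auto simp: fun_eq_iff transpose_def)
    next
      case False
      then have "(c, j) \<in> up_pairs u" using c by simp
      then have up: "above (u \<circ> transpose c j)" by (simp add: up_pairs_def)
      show ?thesis
      proof (cases "u i < u c")
        case True
        then show ?thesis using ij r c
          by (intro above_transposeD[OF up, of i j]) (auto simp: fun_eq_iff transpose_def)
      next
        case False
        then show ?thesis using ij r c
          by (intro above_transpose[OF v]) (auto simp: transpose_def)
      qed
    qed
    then show ?thesis using A by (simp add: up_pairs_def)
  qed
  show "(c, j) \<in> up_pairs ?v" if c: "c < i" "(c, i) \<in> up_pairs u" "(c, j) \<in> up_pairs u" for c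
  proof -
    have A: "A c j" and up: "above (u \<circ> transpose c i)" "above (u \<circ> transpose c j)"
      using c by (simp_all add: up_pairs_def)
    note r = A_range[OF A]
    have ne: "u c \<noteq> u i" "u c \<noteq> u j" using above_inj[OF u] c ij by auto
    consider "u c < u i" | "u i < u c" "u c < u j" | "u j < u c" using ne by linarith
    then have "above (?v \<circ> transpose c j)"
    proof cases
      case 1
      then show ?thesis using ij r c
        by (intro above_transpose[OF v]) (auto simp: transpose_def)
    next
      case 2
      then show ?thesis using ij r c
        by (intro above_transposeD[OF up(1), of i j]) (auto simp: fun_eq_iff transpose_def)
    next
      \<comment> \<open>Two increasing transpositions of the wanted permutation, acting on
        consecutive segments of positions, yield the two given neighbours of
        \<open>u\<close>.\<close>
      case 3
      have "?v \<circ> transpose c j \<circ> transpose i j = u \<circ> transpose c i"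
        "?v \<circ> transpose c j \<circ> transpose c i = u \<circ> transpose c j"
        using ij r c by (auto simp: fun_eq_iff transpose_def)
      moreover have "?v \<circ> transpose c j permutes {1..n}"
        by (rule transpose_permutes[OF perm]) (use ij r c in auto)
      moreover have "(?v \<circ> transpose c j) c < (?v \<circ> transpose c j) i"
        "(?v \<circ> transpose c j) i < (?v \<circ> transpose c j) j"
        using 3 ij r c by (auto simp: transpose_def)
      ultimately show ?thesis
        using above_of_two_transpositions[of "?v \<circ> transpose c j" c i j] up ij r c
        by (simp only:)
    qed
    then show ?thesis using A by (simp add: up_pairs_def)
  qed
  show "(j, c) \<in> up_pairs ?v" if c: "j < c" "(i, c) \<in> up_pairs u \<or> (j, c) \<in> up_pairs u" for c
  proof -
    have A: "A j c" using c A_sub[of i c j c] ij by (auto simp: up_pairs_def)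
    note r = A_range[OF A]
    have "above (?v \<circ> transpose j c)"
    proof (cases "(j, c) \<in> up_pairs u")
      case True
      then have up: "above (u \<circ> transpose j c)" by (simp add: up_pairs_def)
      show ?thesis using ij r c
        by (intro above_transposeD[OF up, of i c]) (auto simp: fun_eq_iff transpose_def)
    next
      case False
      then have "(i, c) \<in> up_pairs u" using c by simp
      then have up: "above (u \<circ> transpose i c)" by (simp add: up_pairs_def)
      show ?thesis
      proof (cases "u c < u j")
        case True
        then show ?thesis using ij r c
          by (intro above_transposeD[OF up, of i j]) (auto simp: fun_eq_iff transpose_def)
      next
        case False
        then show ?thesis using ij r c
          by (intro above_transpose[OF v]) (auto simp: transpose_def)
      qed
    qed
    then show ?thesis using A by (simp add: up_pairs_def)
  qed
  show "(i, c) \<in> up_pairs ?v" if c: "j < c" "(i, c) \<in> up_pairs u" "(j, c) \<in> up_pairs u" for c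
  proof -
    have A: "A i c" and up: "above (u \<circ> transpose j c)" "above (u \<circ> transpose i c)"
      using c by (simp_all add: up_pairs_def)
    note r = A_range[OF A]
    have ne: "u c \<noteq> u i" "u c \<noteq> u j" using above_inj[OF u] c ij by auto
    consider "u j < u c" | "u i < u c" "u c < u j" | "u c < u i" using ne by linarith
    then have "above (?v \<circ> transpose i c)"
    proof cases
      case 1
      then show ?thesis using ij r c
        by (intro above_transpose[OF v]) (auto simp: transpose_def)
    next
      case 2
      then show ?thesis using ij r c
        by (intro above_transposeD[OF up(1), of i j]) (auto simp: fun_eq_iff transpose_def)
    next
      case 3
      have "?v \<circ> transpose i c \<circ> transpose i j = u \<circ> transpose j c"
        "?v \<circ> transpose i c \<circ> transpose j c = u \<circ> transpose i c"
        using ij r c by (auto simp: fun_eq_iff transpose_def)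
      moreover have "?v \<circ> transpose i c permutes {1..n}"
        by (rule transpose_permutes[OF perm]) (use ij r c in auto)
      moreover have "(?v \<circ> transpose i c) i < (?v \<circ> transpose i c) j"
        "(?v \<circ> transpose i c) j < (?v \<circ> transpose i c) c"
        using 3 ij r c by (auto simp: transpose_def)
      ultimately show ?thesis
        using above_of_two_transpositions[of "?v \<circ> transpose i c" i j c] up ij r c
        by (simp only:)
    qed
    then show ?thesis using A by (simp add: up_pairs_def)
  qed
qed

text \<open>The same blocks as for edges, but membership only involves bounds on single entries. The
  strict versions are what later excludes configurations when the count is constant.\<close>

lemma band_pairs_transpose:
  assumes u: "above u" and ij: "1 \<le> i" "i < j" "j \<le> n" "u i < u j"
  defines "v \<equiv> u \<circ> transpose i j"
  shows card_band_pairs_mono: "card (band_pairs u) \<le> card (band_pairs v)"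
    and card_band_pairs_left: "c < i \<Longrightarrow> (c, i) \<in> band_pairs v \<Longrightarrow> (c, i) \<notin> band_pairs u \<Longrightarrow>
      (c, j) \<notin> band_pairs u \<Longrightarrow> card (band_pairs u) < card (band_pairs v)"
    and card_band_pairs_right: "j < c \<Longrightarrow> (j, c) \<in> band_pairs v \<Longrightarrow> (i, c) \<notin> band_pairs u \<Longrightarrow>
      (j, c) \<notin> band_pairs u \<Longrightarrow> card (band_pairs u) < card (band_pairs v)"
proof -
  have fin: "finite (band_pairs v)"
    unfolding band_pairs_def by (rule finite_A)
  have vi: "v i = u j" and vj: "v j = u i" and vo: "\<And>c. c \<noteq> i \<Longrightarrow> c \<noteq> j \<Longrightarrow> v c = u c"
    by (simp_all add: v_def)
  have uj: "u j \<le> smax j" and ui: "pmin i \<le> u i"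
    using above_band[OF u] ij by simp_all
  have mono: "\<And>q. q \<le> j \<Longrightarrow> smax j \<le> smax q" "\<And>p. i \<le> p \<Longrightarrow> pmin p \<le> pmin i"
    using smax_antimono pmin_antimono ij by simp_all
  have other: "(p, q) \<in> band_pairs v"
    if pq: "(p, q) \<in> band_pairs u" "\<not> (p < i \<and> q \<in> {i, j})" "\<not> (p \<in> {i, j} \<and> j < q)" for p q
  proof -
    have A: "A p q" "u p \<le> smax q" "pmin p \<le> u q" using pq by (auto simp: band_pairs_def)
    note r = A_range[OF A(1)]
    consider "p \<notin> {i, j}" "q \<notin> {i, j}" | "p = i" "q = j" | "p = i" "i < q" "q < j" | "i < p" "p < j" "q = j"
      using pq r \<open>i < j\<close> by fastforce
    then have "v p \<le> smax q \<and> pmin p \<le> v q"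
    proof cases
      case 1
      then show ?thesis using A by (simp add: vo)
    next
      case 2
      then show ?thesis using uj ui vi vj by simp
    next
      case 3
      then show ?thesis using A uj mono(1)[of q] vi vo[of q] by simp
    next
      case 4
      then show ?thesis using A ui mono(2)[of p] vj vo[of p] by simp
    qed
    then show ?thesis using A by (simp add: band_pairs_def)
  qed
  have left: "(c, i) \<in> band_pairs v" if c: "c < i" "(c, i) \<in> band_pairs u \<or> (c, j) \<in> band_pairs u" for c
  proof -
    have "A c i" using c A_sub[of c j c i] ij by (auto simp: band_pairs_def)
    then show ?thesis using c ij mono(1)[of i] vi vo[of c] by (auto simp: band_pairs_def)
  qed
  have left2: "(c, j) \<in> band_pairs v" if c: "c < i" "(c, i) \<in> band_pairs u" "(c, j) \<in> band_pairs u" for c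
    using c ij vj vo[of c] by (auto simp: band_pairs_def)
  have right: "(j, c) \<in> band_pairs v" if c: "j < c" "(i, c) \<in> band_pairs u \<or> (j, c) \<in> band_pairs u" for c
  proof -
    have "A j c" using c A_sub[of i c j c] ij by (auto simp: band_pairs_def)
    then show ?thesis using c ij mono(2)[of j] vj vo[of c] by (auto simp: band_pairs_def)
  qed
  have right2: "(i, c) \<in> band_pairs v" if c: "j < c" "(i, c) \<in> band_pairs u" "(j, c) \<in> band_pairs u" for c
    using c ij vi vo[of c] by (auto simp: band_pairs_def)
  note all = card_pairs_transpose_mono[OF fin \<open>i < j\<close> other left left2 right right2]
  show "card (band_pairs u) \<le> card (band_pairs v)"
    by (rule all(1))
  show "c < i \<Longrightarrow> (c, i) \<in> band_pairs v \<Longrightarrow> (c, i) \<notin> band_pairs u \<Longrightarrow>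
      (c, j) \<notin> band_pairs u \<Longrightarrow> card (band_pairs u) < card (band_pairs v)"
    by (rule all(2))
  show "j < c \<Longrightarrow> (j, c) \<in> band_pairs v \<Longrightarrow> (i, c) \<notin> band_pairs u \<Longrightarrow>
      (j, c) \<notin> band_pairs u \<Longrightarrow> card (band_pairs u) < card (band_pairs v)"
    by (rule all(3))
qed

lemma up_pairs_subset_band_pairs:
  assumes "above u"
  shows "up_pairs u \<subseteq> band_pairs u"
proof
  fix x assume "x \<in> up_pairs u"
  then obtain p q where x: "x = (p, q)" "A p q" "above (u \<circ> transpose p q)"
    by (auto simp: up_pairs_def)
  then show "x \<in> band_pairs u"
    using above_band[OF x(3), of p] above_band[OF x(3), of q] A_range[OF x(2)]
    by (simp add: band_pairs_def)
qed

text \<open>Swapping a descent of \<open>w\<close> would push the rank at position \<open>p\<close>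
  and threshold \<open>w p\<close> below that of \<open>w\<close>.\<close>

lemma up_pairs_w: "(p, q) \<in> up_pairs w \<longleftrightarrow> A p q \<and> w p < w q"
proof -
  have "w p < w q" if A: "A p q" and up: "above (w \<circ> transpose p q)"
  proof (rule ccontr)
    note r = A_range[OF A]
    let ?v = "w \<circ> transpose p q"
    assume "\<not> w p < w q"
    then have "?v p < ?v q" using above_inj[OF above_w, of p q] r by simp
    moreover have "?v \<circ> transpose p q = w" by (simp add: fun_eq_iff)
    ultimately have "rank_count w p (w p) = rank_count ?v p (w p) + 1"
      using rank_count_transpose[of p q ?v p "w p"] r by simp
    then show False using up r unfolding above_rank
      by (metis Suc_eq_plus1 not_less_eq_eq le_refl less_imp_le_nat le_trans)
  qed
  then show ?thesis
    using above_transpose[OF above_w] A_range by (auto simp: up_pairs_def)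
qed

lemma above_longest: "above (longest_perm n)"
  unfolding above_def using longest_perm_permutes bruhat_le_longest_perm[OF w] by simp

text \<open>On the rectangle where the swap lowers the rank by one, \<open>w\<close> stays strictly
  below both terms of the maximal rank: the entry \<open>pmin i\<close> is too small to be counted,
  and the value \<open>smax j\<close> sits too far right.\<close>

lemma band_pairs_longest: "band_pairs (longest_perm n) = up_pairs (longest_perm n)"
proof
  let ?l = "longest_perm n"
  show "up_pairs ?l \<subseteq> band_pairs ?l" using up_pairs_subset_band_pairs above_longest .
  show "band_pairs ?l \<subseteq> up_pairs ?l"
  proof
    fix x assume "x \<in> band_pairs ?l"
    then obtain i j where x: "x = (i, j)" "A i j" "n + 1 - i \<le> smax j" "pmin i \<le> n + 1 - j"
      using A_range by (fastforce simp: band_pairs_def longest_perm_def)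
    note r = A_range[OF x(2)]
    let ?v = "?l \<circ> transpose i j"
    have perm: "?v permutes {1..n}" using transpose_permutes[OF longest_perm_permutes] r by simp
    have "?v \<circ> transpose i j = ?l" by (simp add: fun_eq_iff)
    then have rank: "rank_count ?l p q = rank_count ?v p q +
        (if i \<le> p \<and> p < j \<and> n + 1 - j < q \<and> q \<le> n + 1 - i then 1 else 0)" for p q
    proof -
      have "?v i = n + 1 - j" "?v j = n + 1 - i" using r by (simp_all add: longest_perm_def)
      moreover have "n + 1 - j < n + 1 - i" using r by linarith
      ultimately show ?thesis
        using rank_count_transpose[of i j ?v p q] r \<open>?v \<circ> transpose i j = ?l\<close> by simp
    qed
    obtain a where a: "1 \<le> a" "a \<le> i" "w a = pmin i" using pmin_obtain r by blast
    obtain b where b: "j \<le> b" "b \<le> n" "w b = smax j" using smax_obtain r by blast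
    have "rank_count w p q \<le> rank_count ?v p q" if p: "p \<le> n" for p q
    proof (cases "i \<le> p \<and> p < j \<and> n + 1 - j < q \<and> q \<le> n + 1 - i")
      case True
      have "{e \<in> {1..p}. q \<le> w e} \<subseteq> {1..p} - {a}" using True a x by auto
      then have "rank_count w p q \<le> card ({1..p} - {a})"
        unfolding rank_count_def by (intro card_mono) auto
      also have "\<dots> < p" using True a by (simp add: card_Diff_singleton)
      finally have 1: "rank_count w p q < p" .
      have "w ` {e \<in> {1..p}. q \<le> w e} \<subseteq> {q..n} - {w b}"
      proof
        fix y assume "y \<in> w ` {e \<in> {1..p}. q \<le> w e}"
        then obtain e where e: "1 \<le> e" "e \<le> p" "q \<le> w e" "y = w e" by auto
        then have "w e \<le> n" using permutes_in_image[OF w, of e] p by simp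
        moreover have "w e \<noteq> w b" unfolding above_inj[OF above_w] using e True b by linarith
        ultimately show "y \<in> {q..n} - {w b}" using e by simp
      qed
      then have "card {e \<in> {1..p}. q \<le> w e} \<le> card ({q..n} - {w b})"
        by (intro card_inj_on_le[OF permutes_inj_on[OF w]]) auto
      moreover have "w b \<in> {q..n}" using True b x permutes_in_image[OF w, of b] r by auto
      then have "card ({q..n} - {w b}) < n + 1 - q" by (simp add: card_Diff_singleton, arith)
      ultimately have 2: "rank_count w p q < n + 1 - q" by (simp add: rank_count_def)
      show ?thesis
        using rank[of p q] True 1 2 rank_count_longest_perm[OF p, of q] by simp
    next
      case False
      then show ?thesis
        using rank[of p q, unfolded if_not_P[OF False]] rank_count_longest_perm[OF p, of q] rank_count_bounds[OF w p, of q] by simp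
    qed
    then show "x \<in> up_pairs ?l" using x perm by (simp add: up_pairs_def above_rank)
  qed
qed

lemma cards_le_longest:
  assumes "above u"
  shows card_up_pairs_le_longest: "card (up_pairs u) \<le> card (up_pairs (longest_perm n))"
    and card_band_pairs_le_longest: "card (band_pairs u) \<le> card (band_pairs (longest_perm n))"
proof -
  have u: "u permutes {1..n}" "bruhat_le n w u" using assms by (simp_all add: above_def)
  have *: "card (up_pairs u) \<le> card (up_pairs (longest_perm n)) \<and>
    card (band_pairs u) \<le> card (band_pairs (longest_perm n))"
    using bruhat_le_longest_perm[OF u(1)] u(1)
  proof (induction rule: bruhat_le_induct)
    case (step x i j)
    have "above x" using step u(2) bruhat_le_trans by (auto simp: above_def)
    then show ?case
      using card_up_pairs_mono[of x i j] card_band_pairs_mono[of x i j] step by linarith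
  qed simp
  then show "card (up_pairs u) \<le> card (up_pairs (longest_perm n))"
    "card (band_pairs u) \<le> card (band_pairs (longest_perm n))" by simp_all
qed

lemma cards_ge_w:
  assumes "above u"
  shows card_up_pairs_ge_w: "card (up_pairs w) \<le> card (up_pairs u)"
    and card_band_pairs_ge_w: "card (band_pairs w) \<le> card (band_pairs u)"
proof -
  have "card (up_pairs w) \<le> card (up_pairs u) \<and> card (band_pairs w) \<le> card (band_pairs u)"
    using assms[unfolded above_def, THEN conjunct2] w
  proof (induction rule: bruhat_le_induct)
    case (step x i j)
    have "above x" using step by (auto simp: above_def)
    then show ?case
      using card_up_pairs_mono[of x i j] card_band_pairs_mono[of x i j] step by linarith
  qed simp
  then show "card (up_pairs w) \<le> card (up_pairs u)" "card (band_pairs w) \<le> card (band_pairs u)" by simp_all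
qed

text \<open>The ten patterns in terms of adjacency. The last clause merges the four five-letter
  patterns, which differ only in comparisons of the nonadjacent pairs \<open>i, l\<close> and
  \<open>j, m\<close>.\<close>

definition avoids :: bool where
  "avoids \<longleftrightarrow>
    (\<forall>i j k l. i < j \<and> j < k \<and> k < l \<longrightarrow>
      \<not> (A i l \<and> w j < w i \<and> w i < w l \<and> w l < w k) \<and>
      \<not> (A i k \<and> A j l \<and> w i < w k \<and> w k < w j \<and> w j < w l) \<and>
      \<not> (A i j \<and> A j l \<and> \<not> A i l \<and> w i < w j \<and> w j < w l \<and> w l < w k) \<and>
      \<not> (A i k \<and> A k l \<and> \<not> A i l \<and> w j < w i \<and> w i < w k \<and> w k < w l) \<and>
      \<not> (A i k \<and> A j l \<and> \<not> A i l \<and> w i < w k \<and> w k < w l \<and> w l < w j) \<and>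
      \<not> (A i k \<and> A j l \<and> \<not> A i l \<and> w k < w i \<and> w i < w j \<and> w j < w l)) \<and>
    (\<forall>i j k l m. i < j \<and> j < k \<and> k < l \<and> l < m \<longrightarrow>
      \<not> (A i k \<and> \<not> A i l \<and> A j l \<and> \<not> A j m \<and> A k m \<and>
         w i < w k \<and> w l < w k \<and> w k < w j \<and> w k < w m))"

section \<open>From equal degrees to pattern avoidance\<close>

context
  assumes card_eq: "card (up_pairs (longest_perm n)) = card (up_pairs w)"
begin

text \<open>The degree of \<open>w\<close> is at most its band count, which is at most the band
  count of the longest element, that is, its degree. Equal degrees collapse this chain.\<close>

lemma up_pairs_w_eq_band_pairs: "up_pairs w = band_pairs w"
proof (rule card_subset_eq)
  show "finite (band_pairs w)" unfolding band_pairs_def by (rule finite_A)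
  show sub: "up_pairs w \<subseteq> band_pairs w" using up_pairs_subset_band_pairs above_w .
  have "card (up_pairs w) \<le> card (band_pairs w)"
    by (rule card_mono) (fact)+
  moreover have "card (band_pairs w) \<le> card (up_pairs w)"
    using card_band_pairs_le_longest[OF above_w] card_eq band_pairs_longest by simp
  ultimately show "card (up_pairs w) = card (band_pairs w)" by simp
qed

lemma card_band_pairs_const:
  assumes "above u"
  shows "card (band_pairs u) = card (band_pairs w)"
  using card_band_pairs_ge_w[OF assms] card_band_pairs_le_longest[OF assms]
    card_eq band_pairs_longest up_pairs_w_eq_band_pairs by simp

text \<open>The outer letters put the pair \<open>p, q\<close> into the band, yet as a descent it is
  no edge at \<open>w\<close>.\<close>

lemma no_wide_1324:
  assumes "1 \<le> a" "a < p" "A p q" "q < b" "b \<le> n" "w a < w q" "w q < w p" "w p < w b"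
  shows False
proof -
  have "w b \<le> smax q" "pmin p \<le> w a" using assms by (auto intro: le_smax pmin_le)
  then have "(p, q) \<in> band_pairs w" using assms by (simp add: band_pairs_def)
  then show False using up_pairs_w_eq_band_pairs up_pairs_w assms by auto
qed

text \<open>The pair \<open>p', q\<close> leaves the band because the entry at \<open>p'\<close> is
  too large. Exchanging it with the entry at \<open>p\<close> repairs this, and nothing is lost in
  that block since \<open>p\<close> is not adjacent to \<open>q\<close>; so the band count would
  grow.\<close>

lemma no_left_gap:
  assumes "1 \<le> p" "p < p'" "\<not> A p q" "A p' q" "w p \<le> smax q" "smax q < w p'"
  shows False
proof -
  note r = A_range[OF assms(4)]
  obtain b where b: "q \<le> b" "b \<le> n" "w b = smax q" using smax_obtain r by blast
  \<comment> \<open>The value \<open>smax q\<close> is first brought to \<open>q\<close>, so that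
    the entry there exceeds \<open>w p\<close> and hence \<open>pmin p'\<close>.\<close>
  define u where "u = (if b = q then w else w \<circ> transpose q b)"
  have "w q \<noteq> w b" if "b \<noteq> q" using that above_inj[OF above_w, of q b] by simp
  moreover have "w q \<le> smax q" using le_smax r by simp
  ultimately have u: "above u"
    unfolding u_def using b r above_transpose[OF above_w, of q b] above_w by auto
  have vals: "u q = smax q" "u p = w p" "u p' = w p'"
    using assms b r by (auto simp: u_def transpose_def)
  have "w p \<noteq> w b" using above_inj[OF above_w, of p b] b r assms by simp
  then have lt: "w p < smax q" using assms b by simp
  let ?v = "u \<circ> transpose p p'"
  have v: "above ?v"
    using above_transpose[OF u, of p p'] assms r vals by simp
  have "pmin p' \<le> w p" using pmin_le assms by simp
  then have "(p', q) \<in> band_pairs ?v"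
    using assms r vals lt by (auto simp: band_pairs_def transpose_def)
  moreover have "(p', q) \<notin> band_pairs u" "(p, q) \<notin> band_pairs u"
    using assms vals by (auto simp: band_pairs_def)
  ultimately have "card (band_pairs u) < card (band_pairs ?v)"
    using card_band_pairs_right[OF u, of p p' q] assms r vals by simp
  then show False using card_band_pairs_const u v by simp
qed

text \<open>Mirror image of \<open>no_left_gap\<close>: here the value \<open>pmin p\<close> is
  first brought to \<open>p\<close>.\<close>

lemma no_right_gap:
  assumes "q' < q" "q \<le> n" "A p q'" "\<not> A p q" "w q' < pmin p" "pmin p \<le> w q"
  shows False
proof -
  note r = A_range[OF assms(3)]
  obtain a where a: "1 \<le> a" "a \<le> p" "w a = pmin p" using pmin_obtain r by blast
  define u where "u = (if a = p then w else w \<circ> transpose a p)"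
  have "w p \<noteq> w a" if "a \<noteq> p" using that above_inj[OF above_w, of p a] by simp
  moreover have "pmin p \<le> w p" using pmin_le r by simp
  ultimately have u: "above u"
    unfolding u_def using a r above_transpose[OF above_w, of a p] above_w by auto
  have vals: "u p = pmin p" "u q = w q" "u q' = w q'"
    using assms a r by (auto simp: u_def transpose_def)
  let ?v = "u \<circ> transpose q' q"
  have v: "above ?v"
    using above_transpose[OF u, of q' q] assms r vals by simp
  have "w q \<le> smax q'" using le_smax assms by simp
  then have "(p, q') \<in> band_pairs ?v"
    using assms r vals by (auto simp: band_pairs_def transpose_def)
  moreover have "(p, q') \<notin> band_pairs u" "(p, q) \<notin> band_pairs u"
    using assms vals by (auto simp: band_pairs_def)
  ultimately have "card (band_pairs u) < card (band_pairs ?v)"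
    using card_band_pairs_left[OF u, of q' q p] assms r vals by simp
  then show False using card_band_pairs_const u v by simp
qed

text \<open>The letters pass through 4123 to 4321. In 4123 neither \<open>i, j\<close> nor
  \<open>i, l\<close> is a band pair, since 1 is below \<open>pmin i\<close> and 4 above
  \<open>smax l\<close>; in 4321 the pair \<open>i, j\<close> is one, so the second step increases
  the count.\<close>

lemma no_extreme_2143:
  assumes "i < j" "j < k" "k < l" "A i l" "w j < pmin i" "w i < w l" "smax l < w k"
  shows False
proof -
  note r = A_range[OF assms(4)]
  have le: "pmin i \<le> w i" "w l \<le> smax l" using pmin_le le_smax r by simp_all
  let ?u = "w \<circ> transpose i k" and ?v = "w \<circ> transpose i k \<circ> transpose j l"
  have u: "above ?u"
    using above_transpose[OF above_w, of i k] assms le r by simp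
  have vals: "?u i = w k" "?u j = w j" "?u l = w l" using assms by auto
  have v: "above ?v"
    using above_transpose[OF u, of j l] assms le r vals by simp
  have "w k \<le> smax j" using le_smax[of j k] assms r by simp
  then have "(i, j) \<in> band_pairs ?v"
    using assms A_sub[of i l i j] le by (auto simp: band_pairs_def transpose_def)
  moreover have "(i, j) \<notin> band_pairs ?u" "(i, l) \<notin> band_pairs ?u"
    using assms vals by (auto simp: band_pairs_def)
  ultimately have "card (band_pairs ?u) < card (band_pairs ?v)"
    using card_band_pairs_left[OF u, of j l i] assms le r vals by simp
  then show False using card_band_pairs_const u v by simp
qed

text \<open>Makes a descent extreme: either its larger letter exceeds everything from
  \<open>q\<close> on, or a larger entry further right is available as the last letter of a wide
  1324.\<close>

lemma smax_less_or_exceeded: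
  assumes "p < q" "q \<le> n" "w q < w p"
  shows "smax q < w p \<or> (\<exists>b>q. b \<le> n \<and> w p < w b)"
proof -
  obtain b where b: "q \<le> b" "b \<le> n" "w b = smax q" using smax_obtain assms by blast
  then have "w p \<noteq> w b" using above_inj[OF above_w, of p b] assms by simp
  moreover have "b = q \<Longrightarrow> smax q < w p" using b assms by simp
  ultimately show ?thesis using b by (metis linorder_neqE_nat nat_less_le)
qed

lemma less_pmin_or_undercut:
  assumes "1 \<le> p" "p < q" "w q < w p"
  shows "w q < pmin p \<or> (\<exists>a<p. 1 \<le> a \<and> w a < w q)"
proof -
  obtain a where a: "1 \<le> a" "a \<le> p" "w a = pmin p" using pmin_obtain assms by blast
  then have "w q \<noteq> w a" using above_inj[OF above_w, of q a] assms by simp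
  moreover have "a = p \<Longrightarrow> w q < pmin p" using a assms by simp
  ultimately show ?thesis using a by (metis linorder_neqE_nat nat_less_le)
qed

lemma avoids_if_card_eq: avoids
  unfolding avoids_def
proof (rule conjI; intro allI impI)
  fix i j k l :: nat assume "i < j \<and> j < k \<and> k < l"
  then have o: "i < j" "j < k" "k < l" by auto
  have "\<not> (A i l \<and> w j < w i \<and> w i < w l \<and> w l < w k)"
  proof
    assume *: "A i l \<and> w j < w i \<and> w i < w l \<and> w l < w k"
    note r = A_range[OF *[THEN conjunct1]]
    have A: "A i j" "A k l" using * A_sub[of i l i j] A_sub[of i l k l] o by auto
    have "smax l < w k"
      using smax_less_or_exceeded[of k l] no_wide_1324[of i k l] A * r o by auto
    moreover have "w j < pmin i"
      using less_pmin_or_undercut[of i j] no_wide_1324[of _ i j l] A * r o by auto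
    ultimately show False using no_extreme_2143 o * by blast
  qed
  moreover have "\<not> (A i k \<and> A j l \<and> w i < w k \<and> w k < w j \<and> w j < w l)"
    using no_wide_1324[of i j k l] A_range[of i k] A_range[of j l] A_sub[of i k j k] o by auto
  moreover have "\<not> (A i j \<and> A j l \<and> \<not> A i l \<and> w i < w j \<and> w j < w l \<and> w l < w k)"
  proof
    assume *: "A i j \<and> A j l \<and> \<not> A i l \<and> w i < w j \<and> w j < w l \<and> w l < w k"
    have r: "1 \<le> i" "l \<le> n" and A: "A k l" using * A_range A_sub[of j l k l] o by auto
    have "smax l < w k"
      using smax_less_or_exceeded[of k l] no_wide_1324[of i k l] A * r o by auto
    moreover have "w l \<le> smax l" using le_smax r by simp
    ultimately show False using no_left_gap[of i k l] A * r o by auto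
  qed
  moreover have "\<not> (A i k \<and> A k l \<and> \<not> A i l \<and> w j < w i \<and> w i < w k \<and> w k < w l)"
  proof
    assume *: "A i k \<and> A k l \<and> \<not> A i l \<and> w j < w i \<and> w i < w k \<and> w k < w l"
    have r: "1 \<le> i" "l \<le> n" and A: "A i j" using * A_range A_sub[of i k i j] o by auto
    have "w j < pmin i"
      using less_pmin_or_undercut[of i j] no_wide_1324[of _ i j l] A * r o by auto
    moreover have "pmin i \<le> w i" using pmin_le r by simp
    ultimately show False using no_right_gap[of j l i] A * r o by auto
  qed
  moreover have "\<not> (A i k \<and> A j l \<and> \<not> A i l \<and> w i < w k \<and> w k < w l \<and> w l < w j)"
  proof
    assume *: "A i k \<and> A j l \<and> \<not> A i l \<and> w i < w k \<and> w k < w l \<and> w l < w j"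
    have r: "1 \<le> i" "l \<le> n" and A: "A j k" using * A_range A_sub[of i k j k] o by auto
    have "smax l < w j"
    proof (rule ccontr)
      assume "\<not> smax l < w j"
      then obtain b where "l < b" "b \<le> n" "w j < w b"
        using smax_less_or_exceeded[of j l] * r o by auto
      then show False using no_wide_1324[of i j k b] A * r o by auto
    qed
    moreover have "w l \<le> smax l" using le_smax r by simp
    ultimately show False using no_left_gap[of i j l] A * r o by auto
  qed
  moreover have "\<not> (A i k \<and> A j l \<and> \<not> A i l \<and> w k < w i \<and> w i < w j \<and> w j < w l)"
  proof
    assume *: "A i k \<and> A j l \<and> \<not> A i l \<and> w k < w i \<and> w i < w j \<and> w j < w l"
    have r: "1 \<le> i" "l \<le> n" using * A_range by auto
    have "w k < pmin i"
      using less_pmin_or_undercut[of i k] no_wide_1324[of _ i k l] * r o by auto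
    moreover have "pmin i \<le> w i" using pmin_le r by simp
    ultimately show False using no_right_gap[of k l i] * r o by auto
  qed
  ultimately show "\<not> (A i l \<and> w j < w i \<and> w i < w l \<and> w l < w k) \<and>
      \<not> (A i k \<and> A j l \<and> w i < w k \<and> w k < w j \<and> w j < w l) \<and>
      \<not> (A i j \<and> A j l \<and> \<not> A i l \<and> w i < w j \<and> w j < w l \<and> w l < w k) \<and>
      \<not> (A i k \<and> A k l \<and> \<not> A i l \<and> w j < w i \<and> w i < w k \<and> w k < w l) \<and>
      \<not> (A i k \<and> A j l \<and> \<not> A i l \<and> w i < w k \<and> w k < w l \<and> w l < w j) \<and>
      \<not> (A i k \<and> A j l \<and> \<not> A i l \<and> w k < w i \<and> w i < w j \<and> w j < w l)"
    by (intro conjI)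
next
  fix i j k l m :: nat assume "i < j \<and> j < k \<and> k < l \<and> l < m"
  then have o: "i < j" "j < k" "k < l" "l < m" by auto
  show "\<not> (A i k \<and> \<not> A i l \<and> A j l \<and> \<not> A j m \<and> A k m \<and>
    w i < w k \<and> w l < w k \<and> w k < w j \<and> w k < w m)"
  proof
    assume *: "A i k \<and> \<not> A i l \<and> A j l \<and> \<not> A j m \<and> A k m \<and>
      w i < w k \<and> w l < w k \<and> w k < w j \<and> w k < w m"
    have r: "1 \<le> i" "m \<le> n" and A: "A j k" using * A_range A_sub[of i k j k] o by auto
    \<comment> \<open>The letters at \<open>i, j, k\<close> form 132, and a larger entry after
      \<open>k\<close> would complete a wide 1324. So \<open>w j\<close> exceeds every entry after
      \<open>k\<close>, and \<open>i, j\<close> form a left gap at \<open>l\<close>.\<close>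
    have *: "\<not> w j < w b" if "b > k" "b \<le> n" for b
      using no_wide_1324[of i j k b] that A * r o by auto
    have "smax l < w j"
      using smax_less_or_exceeded[of j l] * r o \<open>A i k \<and> _\<close> by auto
    moreover have "w m \<le> smax l" using le_smax r o by simp
    ultimately show False using no_left_gap[of i j l] \<open>A i k \<and> _\<close> r o by auto
  qed
qed

end

end

section \<open>Pattern avoidance and generators\<close>

text \<open>A discrete intermediate value argument: it finds the step at which a path leaves
  \<open>P\<close>, which is how remote letters get replaced by adjacent ones.\<close>

lemma rtranclp_crossing:
  assumes "r\<^sup>*\<^sup>* x y" "P x" "\<not> P y"
  obtains a b where "r\<^sup>*\<^sup>* x a" "r a b" "r\<^sup>*\<^sup>* b y" "P a" "\<not> P b"
proof -
  have "P y \<or> (\<exists>a b. r\<^sup>*\<^sup>* x a \<and> r a b \<and> r\<^sup>*\<^sup>* b y \<and> P a \<and> \<not> P b)"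
    using assms(1)
  proof (induction rule: rtranclp_induct)
    case (step y z)
    then show ?case by (meson rtranclp.rtrancl_into_rtrancl rtranclp.rtrancl_refl)
  qed (use assms in simp)
  then show ?thesis using assms(3) that by blast
qed

context hess_perm
begin

definition climb :: "nat \<Rightarrow> nat \<Rightarrow> bool" where
  "climb x y \<longleftrightarrow> A x y \<and> w x < w y"

lemma climb_path_mono:
  assumes "climb\<^sup>*\<^sup>* x y"
  shows "x \<le> y" "w x \<le> w y" "x \<noteq> y \<Longrightarrow> w x < w y"
proof -
  have "x \<le> y \<and> w x \<le> w y \<and> (x \<noteq> y \<longrightarrow> w x < w y)"
    using assms
  proof (induction rule: rtranclp_induct)
    case (step y z)
    then show ?case using A_range[of y z] by (auto simp: climb_def)
  qed simp
  then show "x \<le> y" "w x \<le> w y" "x \<noteq> y \<Longrightarrow> w x < w y" by auto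
qed

end

text \<open>The path property stands in for being a generator; \<open>generator_climb_path\<close>
  supplies it.\<close>

locale hess_generator = hess_perm +
  assumes climb_path: "1 \<le> p \<Longrightarrow> p < q \<Longrightarrow> q \<le> n \<Longrightarrow> w p < w q \<Longrightarrow> climb\<^sup>*\<^sup>* p q"
    and avoids: avoids
begin

lemma no_2143:
  "i < j \<Longrightarrow> j < k \<Longrightarrow> k < l \<Longrightarrow> A i l \<Longrightarrow> w j < w i \<Longrightarrow> w i < w l \<Longrightarrow> w l < w k \<Longrightarrow> False"
  using avoids[unfolded avoids_def, THEN conjunct1, rule_format, of i j k l] by blast

lemma no_1324:
  "i < j \<Longrightarrow> j < k \<Longrightarrow> k < l \<Longrightarrow> A i k \<Longrightarrow> A j l \<Longrightarrow> w i < w k \<Longrightarrow> w k < w j \<Longrightarrow> w j < w l \<Longrightarrow> False"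
  using avoids[unfolded avoids_def, THEN conjunct1, rule_format, of i j k l] by blast

lemma no_1243:
  "i < j \<Longrightarrow> j < k \<Longrightarrow> k < l \<Longrightarrow> A i j \<Longrightarrow> A j l \<Longrightarrow> \<not> A i l \<Longrightarrow> w i < w j \<Longrightarrow> w j < w l \<Longrightarrow> w l < w k \<Longrightarrow> False"
  using avoids[unfolded avoids_def, THEN conjunct1, rule_format, of i j k l] by blast

lemma no_2134:
  "i < j \<Longrightarrow> j < k \<Longrightarrow> k < l \<Longrightarrow> A i k \<Longrightarrow> A k l \<Longrightarrow> \<not> A i l \<Longrightarrow> w j < w i \<Longrightarrow> w i < w k \<Longrightarrow> w k < w l \<Longrightarrow> False"
  using avoids[unfolded avoids_def, THEN conjunct1, rule_format, of i j k l] by blast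

lemma no_1423:
  "i < j \<Longrightarrow> j < k \<Longrightarrow> k < l \<Longrightarrow> A i k \<Longrightarrow> A j l \<Longrightarrow> \<not> A i l \<Longrightarrow> w i < w k \<Longrightarrow> w k < w l \<Longrightarrow> w l < w j \<Longrightarrow> False"
  using avoids[unfolded avoids_def, THEN conjunct1, rule_format, of i j k l] by blast

lemma no_2314:
  "i < j \<Longrightarrow> j < k \<Longrightarrow> k < l \<Longrightarrow> A i k \<Longrightarrow> A j l \<Longrightarrow> \<not> A i l \<Longrightarrow> w k < w i \<Longrightarrow> w i < w j \<Longrightarrow> w j < w l \<Longrightarrow> False"
  using avoids[unfolded avoids_def, THEN conjunct1, rule_format, of i j k l] by blast

lemma no_five_letter:
  "i < j \<Longrightarrow> j < k \<Longrightarrow> k < l \<Longrightarrow> l < m \<Longrightarrow> A i k \<Longrightarrow> \<not> A i l \<Longrightarrow> A j l \<Longrightarrow> \<not> A j m \<Longrightarrow> A k m \<Longrightarrow>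
    w i < w k \<Longrightarrow> w l < w k \<Longrightarrow> w k < w j \<Longrightarrow> w k < w m \<Longrightarrow> False"
  using avoids[unfolded avoids_def, THEN conjunct2, rule_format, of i j k l m] by blast

text \<open>Both outer letters are pulled in. The path from \<open>a\<close> to \<open>q\<close>
  jumps over \<open>p\<close> by a step ending at some \<open>x\<close> with entry below
  \<open>w p\<close>; the path from \<open>p\<close> to \<open>b\<close> then jumps over
  \<open>x\<close>. The two steps together form a 1324 with the required adjacencies.\<close>

lemma generator_no_wide_1324:
  assumes "1 \<le> a" "a < p" "A p q" "q < b" "b \<le> n" "w a < w q" "w q < w p" "w p < w b"
  shows False
proof -
  note r = A_range[OF assms(3)]
  have "climb\<^sup>*\<^sup>* a q" using climb_path[of a q] assms r by simp
  then obtain a' x where ax: "climb\<^sup>*\<^sup>* a a'" "climb a' x" "climb\<^sup>*\<^sup>* x q" "a' < p" "\<not> x < p"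
    by (rule rtranclp_crossing[where P = "\<lambda>z. z < p"]) (use assms r in auto)
  note m = climb_path_mono[OF ax(3)] climb_path_mono[OF ax(1)]
  have "w x < w p" using m(2) assms by simp
  moreover from this have "x \<noteq> p" by auto
  ultimately have x: "p < x" "w x < w p" using ax(5) by simp_all
  have "climb\<^sup>*\<^sup>* p b" using climb_path[of p b] assms r by simp
  then obtain y z where yz: "climb\<^sup>*\<^sup>* p y" "climb y z" "climb\<^sup>*\<^sup>* z b" "y \<le> x" "\<not> z \<le> x"
    by (rule rtranclp_crossing[where P = "\<lambda>z. z \<le> x"]) (use assms r m x in auto)
  note m' = climb_path_mono[OF yz(1)]
  have "y \<noteq> x" using m'(2) x by auto
  then show False
    using no_1324[of a' y x z] ax yz m'(1,2) x by (auto simp: climb_def)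
qed

text \<open>The path from \<open>p\<close> to the position of \<open>smax q\<close> jumps over
  \<open>p'\<close> while staying below \<open>w p'\<close>. A pattern appears where adjacency
  changes along this path.\<close>

lemma generator_no_left_gap:
  assumes "1 \<le> p" "p < p'" "\<not> A p q" "A p' q" "w p \<le> smax q" "smax q < w p'"
  shows False
proof -
  note r = A_range[OF assms(4)]
  obtain b where b: "q \<le> b" "b \<le> n" "w b = smax q" using smax_obtain r by blast
  have "w p \<noteq> w b" using above_inj[OF above_w, of p b] b r assms by simp
  then have "climb\<^sup>*\<^sup>* p b" using climb_path[of p b] b assms r by simp
  then obtain e f where ef: "climb\<^sup>*\<^sup>* p e" "climb e f" "climb\<^sup>*\<^sup>* f b" "e < p'" "\<not> f < p'"
    by (rule rtranclp_crossing[where P = "\<lambda>z. z < p'"]) (use assms r b in auto)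
  note mf = climb_path_mono[OF ef(3)] and me = climb_path_mono[OF ef(1)]
  have "w f < w p'" using mf(2) assms b by simp
  moreover from this have "f \<noteq> p'" by auto
  ultimately have f: "p' < f" "w f < w p'" using ef(5) by simp_all
  have Aef: "A e f" using ef by (simp add: climb_def)
  show False
  proof (cases "A p f")
    case False
    \<comment> \<open>Adjacency to \<open>f\<close> is gained somewhere between \<open>p\<close> and
      \<open>e\<close>; that step gives 1243, with \<open>p'\<close> as its largest letter and
      \<open>f\<close> as its last position.\<close>
    from ef(1) obtain x y where xy: "climb\<^sup>*\<^sup>* p x" "climb x y" "climb\<^sup>*\<^sup>* y e" "\<not> A x f" "A y f"
      by (rule rtranclp_crossing[where P = "\<lambda>z. \<not> A z f"]) (use False Aef in auto)
    note my = climb_path_mono[OF xy(3)]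
    have "w y < w f" using my ef(2) by (auto simp: climb_def)
    then show False
      using no_1243[of x y p' f] xy my(1) ef f A_range[of x y] by (auto simp: climb_def)
  next
    case True
    have nA: "\<not> A p b" using A_sub[of p b p q] b assms r by auto
    \<comment> \<open>The step \<open>x, y\<close> at which adjacency to \<open>p\<close> is lost
      gives 1423 together with \<open>p, p'\<close>, provided that \<open>p'\<close> is adjacent to
      \<open>y\<close>.\<close>
    from ef(3) obtain x y where xy: "climb\<^sup>*\<^sup>* f x" "climb x y" "climb\<^sup>*\<^sup>* y b" "A p x" "\<not> A p y"
      by (rule rtranclp_crossing[where P = "\<lambda>z. A p z"]) (use True nA in auto)
    note mx = climb_path_mono[OF xy(1)] and my = climb_path_mono[OF xy(3)]
    have vals: "w p < w x" "w x < w y" "w y < w p'" and A: "A x y"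
      using me mx my xy(2) ef(2) assms b by (auto simp: climb_def)
    have pos: "p' < x" "x < y" "x < q"
      using mx f A_range[OF A] xy(4) A_sub[of p x p q] assms r by (auto simp: not_less[symmetric])
    show False
    proof (cases "A p' y")
      case True
      then show False
        using no_1423[of p p' x y] xy pos vals assms by simp
    next
      case False
      \<comment> \<open>Now \<open>q\<close> lies between \<open>x\<close> and \<open>y\<close>. If
        its entry exceeds \<open>w x\<close>, it replaces \<open>y\<close> in the 1423; if not,
        \<open>p, p', x, q, y\<close> form the merged five-letter pattern.\<close>
      then have "q < y" using A_sub[of p' q p' y] assms(4) pos by (auto simp: not_less[symmetric])
      have "w q \<le> smax q" using le_smax r by simp
      have "w x \<noteq> w q" using above_inj[OF above_w, of x q] pos by simp
      show False
      proof (cases "w x < w q")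
        case True
        then show False
          using no_1423[of p p' x q] xy pos vals assms \<open>w q \<le> smax q\<close> by simp
      next
        case False
        then show False
          using no_five_letter[of p p' x q y] xy pos vals assms \<open>\<not> A p' y\<close> \<open>q < y\<close> \<open>w x \<noteq> w q\<close> A by simp
      qed
    qed
  qed
qed

text \<open>Mirror image of \<open>generator_no_left_gap\<close>, with 2134 and 2314 in place of
  1243 and 1423.\<close>

lemma generator_no_right_gap:
  assumes "q' < q" "q \<le> n" "A p q'" "\<not> A p q" "w q' < pmin p" "pmin p \<le> w q"
  shows False
proof -
  note r = A_range[OF assms(3)]
  obtain a where a: "1 \<le> a" "a \<le> p" "w a = pmin p" using pmin_obtain r by blast
  have "w a \<noteq> w q" using above_inj[OF above_w, of a q] a r assms by simp
  then have "climb\<^sup>*\<^sup>* a q" using climb_path[of a q] a assms r by simp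
  then obtain e f where ef: "climb\<^sup>*\<^sup>* a e" "climb e f" "climb\<^sup>*\<^sup>* f q" "e < q'" "\<not> f < q'"
    by (rule rtranclp_crossing[where P = "\<lambda>z. z < q'"]) (use assms r a in auto)
  note mf = climb_path_mono[OF ef(3)] and me = climb_path_mono[OF ef(1)]
  have e: "w q' < w e" using me(2) assms a by simp
  have Aef: "A e f" and "w e < w f" using ef by (simp_all add: climb_def)
  then have "f \<noteq> q'" using e by auto
  then have f: "q' < f" using ef(5) by simp
  show False
  proof (cases "A e q")
    case False
    from ef(3) obtain x y where xy: "climb\<^sup>*\<^sup>* f x" "climb x y" "climb\<^sup>*\<^sup>* y q" "A e x" "\<not> A e y"
      by (rule rtranclp_crossing[where P = "\<lambda>z. A e z"]) (use False Aef in auto)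
    note mx = climb_path_mono[OF xy(1)]
    show False
      using no_2134[of e q' x y] xy mx(1,2) ef e f \<open>w e < w f\<close> A_range[of x y] by (auto simp: climb_def)
  next
    case True
    have nA: "\<not> A a q" using A_sub[of a q p q] a assms r by auto
    from ef(1) obtain x y where xy: "climb\<^sup>*\<^sup>* a x" "climb x y" "climb\<^sup>*\<^sup>* y e" "\<not> A x q" "A y q"
      by (rule rtranclp_crossing[where P = "\<lambda>z. \<not> A z q"]) (use True nA in auto)
    note mx = climb_path_mono[OF xy(1)] and my = climb_path_mono[OF xy(3)]
    have vals: "w q' < w x" "w x < w y" "w y < w q" and A: "A x y"
      using me mx my mf xy(2) ef(2) assms a by (auto simp: climb_def)
    have pos: "y < q'" "x < y" "p < y"
      using my ef A_range[OF A] xy(5) A_sub[of y q p q] assms r by (auto simp: not_less[symmetric])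
    show False
    proof (cases "A x q'")
      case True
      then show False
        using no_2314[of x y q' q] xy pos vals assms by simp
    next
      case False
      then have "x < p" using A_sub[of p q' x q'] assms(3) pos by (auto simp: not_less[symmetric])
      have "pmin p \<le> w p" using pmin_le r by simp
      have "w y \<noteq> w p" using above_inj[OF above_w, of y p] pos by simp
      show False
      proof (cases "w p < w y")
        case True
        then show False
          using no_2314[of p y q' q] xy pos vals assms \<open>pmin p \<le> w p\<close> by simp
      next
        case False
        then show False
          using no_five_letter[of x p y q' q] xy pos vals assms \<open>\<not> A x q'\<close> \<open>x < p\<close> \<open>w y \<noteq> w p\<close> A by simp
      qed
    qed
  qed
qed

text \<open>A descent inside the band would be the middle of a wide 1324 whose outer letters sit
  where \<open>pmin p\<close> and \<open>smax q\<close> are attained.\<close>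

lemma generator_band_pairs_w: "band_pairs w = up_pairs w"
proof
  show "up_pairs w \<subseteq> band_pairs w" using up_pairs_subset_band_pairs above_w .
  show "band_pairs w \<subseteq> up_pairs w"
  proof
    fix x assume "x \<in> band_pairs w"
    then obtain p q where x: "x = (p, q)" "A p q" "w p \<le> smax q" "pmin p \<le> w q"
      by (auto simp: band_pairs_def)
    note r = A_range[OF x(2)]
    obtain a where a: "1 \<le> a" "a \<le> p" "w a = pmin p" using pmin_obtain r by blast
    obtain b where b: "q \<le> b" "b \<le> n" "w b = smax q" using smax_obtain r by blast
    have ne: "w p \<noteq> w b" "w q \<noteq> w a" "w p \<noteq> w q"
      using above_inj[OF above_w, of p b] above_inj[OF above_w, of q a] above_inj[OF above_w, of p q] a b r
      by simp_all
    have "w p < w q"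
    proof (rule ccontr)
      assume "\<not> w p < w q"
      then have "w q < w p" using ne by simp
      moreover from this have "a \<noteq> p" "b \<noteq> q" using a b x by auto
      ultimately show False
        using generator_no_wide_1324[of a p q b] a b x ne by simp
    qed
    then show "x \<in> up_pairs w" using x up_pairs_w by simp
  qed
qed

end

section \<open>Counting pairs inside the band\<close>

lemma card_permutes_values:
  assumes "u permutes S" "V \<subseteq> S"
  shows "card {p \<in> S. u p \<in> V} = card V"
proof -
  have "u ` {p \<in> S. u p \<in> V} = V"
  proof
    show "V \<subseteq> u ` {p \<in> S. u p \<in> V}"
    proof
      fix v assume "v \<in> V"
      then obtain p where "p \<in> S" "u p = v"
        using assms permutes_image[OF assms(1)] by (metis imageE subsetD)
      then show "v \<in> u ` {p \<in> S. u p \<in> V}" using \<open>v \<in> V\<close> by auto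
    qed
  qed auto
  then show ?thesis
    using card_image[OF permutes_inj_on[OF assms(1)], of "{p \<in> S. u p \<in> V}"] by simp
qed

lemma card_pairs_le_if_sections_le:
  fixes R R' :: "nat \<Rightarrow> nat \<Rightarrow> bool"
  assumes "\<And>p q. R p q \<Longrightarrow> p \<le> n \<and> q \<le> n" "\<And>p q. R' p q \<Longrightarrow> p \<le> n \<and> q \<le> n"
  shows "(\<And>p. card {q. R p q} \<le> card {q. R' p q}) \<Longrightarrow> card {(p, q). R p q} \<le> card {(p, q). R' p q}"
    and "(\<And>q. card {p. R p q} \<le> card {p. R' p q}) \<Longrightarrow> card {(p, q). R p q} \<le> card {(p, q). R' p q}"
proof -
  have fst: "card {(p, q). R p q} = (\<Sum>p\<le>n. card {q. R p q})"
    if "\<And>p q. R p q \<Longrightarrow> p \<le> n \<and> q \<le> n" for R :: "nat \<Rightarrow> nat \<Rightarrow> bool"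
  proof -
    have "{(p, q). R p q} = (SIGMA p:{..n}. {q. R p q})" using that by auto
    moreover have "finite {q. R p q}" for p
      by (rule finite_subset[of _ "{..n}"]) (use that in auto)
    ultimately show ?thesis by simp
  qed
  have snd: "card {(p, q). R p q} = card {(q, p). R p q}" for R :: "nat \<Rightarrow> nat \<Rightarrow> bool"
    by (rule bij_betw_same_card[of prod.swap]) (auto simp: bij_betw_def inj_on_def image_iff)
  show "card {(p, q). R p q} \<le> card {(p, q). R' p q}" if "\<And>p. card {q. R p q} \<le> card {q. R' p q}"
  proof -
    have "card {(p, q). R p q} = (\<Sum>p\<le>n. card {q. R p q})" by (rule fst) (rule assms(1))
    moreover have "card {(p, q). R' p q} = (\<Sum>p\<le>n. card {q. R' p q})" by (rule fst) (rule assms(2))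
    ultimately show ?thesis using that by (simp add: sum_mono)
  qed
  show "card {(p, q). R p q} \<le> card {(p, q). R' p q}" if "\<And>q. card {p. R p q} \<le> card {p. R' p q}"
  proof -
    have "card {(p, q). R p q} = (\<Sum>q\<le>n. card {p. R p q})"
      by (subst snd, rule fst) (use assms(1) in blast)
    moreover have "card {(p, q). R' p q} = (\<Sum>q\<le>n. card {p. R' p q})"
      by (subst snd, rule fst) (use assms(2) in blast)
    ultimately show ?thesis using that by (simp add: sum_mono)
  qed
qed

context hess_perm
begin

lemma smax_range:
  assumes "1 \<le> q" "q \<le> n"
  shows "1 \<le> smax q" "smax q \<le> n"
proof -
  obtain b where b: "q \<le> b" "b \<le> n" "w b = smax q" using smax_obtain assms by blast
  then show "1 \<le> smax q" "smax q \<le> n" using permutes_in_image[OF w, of b] assms by auto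
qed

lemma pmin_range:
  assumes "1 \<le> p" "p \<le> n"
  shows "1 \<le> pmin p" "pmin p \<le> n"
proof -
  obtain a where a: "1 \<le> a" "a \<le> p" "w a = pmin p" using pmin_obtain assms by blast
  then show "1 \<le> pmin p" "pmin p \<le> n" using permutes_in_image[OF w, of a] assms by auto
qed

text \<open>The positions too large for the band at \<open>q\<close>. The longest element has
  equally many entries above \<open>smax q\<close>, namely at the first \<open>n - smax q\<close>
  positions; this makes the later comparisons possible.\<close>

definition tall :: "nat \<Rightarrow> nat set" where
  "tall q = {p \<in> {1..n}. smax q < w p}"

definition short :: "nat \<Rightarrow> nat set" where
  "short p = {q \<in> {1..n}. w q < pmin p}"

lemma tall_less: "p \<in> tall q \<Longrightarrow> p < q"
  using le_smax[of q p] by (auto simp: tall_def not_less[symmetric])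

lemma short_greater: "q \<in> short p \<Longrightarrow> p < q"
  using pmin_le[of q p] by (auto simp: short_def not_less[symmetric])

lemma card_tall: "1 \<le> q \<Longrightarrow> q \<le> n \<Longrightarrow> card (tall q) = n - smax q"
proof -
  assume q: "1 \<le> q" "q \<le> n"
  have "tall q = {p \<in> {1..n}. w p \<in> {Suc (smax q)..n}}"
  proof -
    have "w p \<in> {Suc (smax q)..n} \<longleftrightarrow> smax q < w p" if "p \<in> {1..n}" for p
      using permutes_in_image[OF w, of p] that by auto
    then show ?thesis by (auto simp: tall_def)
  qed
  then show ?thesis using card_permutes_values[OF w, of "{Suc (smax q)..n}"] by simp
qed

lemma card_short: "1 \<le> p \<Longrightarrow> p \<le> n \<Longrightarrow> card (short p) = pmin p - 1"
proof -
  assume p: "1 \<le> p" "p \<le> n"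
  have "short p = {q \<in> {1..n}. w q \<in> {1..pmin p - 1}}"
  proof -
    have "w q \<in> {1..pmin p - 1} \<longleftrightarrow> w q < pmin p" if "q \<in> {1..n}" for q
      using permutes_in_image[OF w, of q] that by auto
    then show ?thesis by (auto simp: short_def)
  qed
  then show ?thesis using card_permutes_values[OF w, of "{1..pmin p - 1}"] pmin_range[OF p] by fastforce
qed

lemma smax_gt:
  assumes "1 \<le> q" "q \<le> n"
  shows "n - smax q < q"
proof -
  have "tall q \<subseteq> {1..n}" by (auto simp: tall_def)
  then have "tall q \<subseteq> {1..<q}" using tall_less by auto
  then have "card (tall q) \<le> card {1..<q}" by (intro card_mono) auto
  then show ?thesis using card_tall[OF assms] assms by simp
qed

lemma finite_tall: "finite (tall q)" and finite_short: "finite (short p)"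
  by (simp_all add: tall_def short_def)

lemma A_column:
  assumes "1 \<le> q" "q \<le> n"
  obtains g where "g < q" "\<And>p. A p q \<longleftrightarrow> g < p \<and> p < q"
proof -
  define L where "L = (LEAST p. 1 \<le> p \<and> (p = q \<or> A p q))"
  have L: "1 \<le> L" "L = q \<or> A L q"
    using LeastI[of "\<lambda>p. 1 \<le> p \<and> (p = q \<or> A p q)" q] assms unfolding L_def by auto
  have least: "L \<le> p" if "1 \<le> p" "p = q \<or> A p q" for p
    unfolding L_def by (rule Least_le) (use that in simp)
  show thesis
  proof (rule that[of "L - 1"])
    show "L - 1 < q" using L least[of q] assms by simp
    fix p
    show "A p q \<longleftrightarrow> L - 1 < p \<and> p < q"
      using L least[of p] A_range[of p q] A_sub[of L q p q] by auto
  qed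
qed

lemma A_row:
  assumes "1 \<le> p" "p \<le> n"
  obtains g where "p \<le> g" "g \<le> n" "\<And>q. A p q \<longleftrightarrow> p < q \<and> q \<le> g"
proof -
  define G where "G = Max (insert p {q. A p q})"
  have fin: "finite {q. A p q}" by (rule finite_subset[of _ "{..n}"]) (use A_range in auto)
  then have G: "G = p \<or> A p G" using Max_in[of "insert p {q. A p q}"] unfolding G_def by auto
  have ge: "q \<le> G" if "q = p \<or> A p q" for q
    unfolding G_def by (rule Max_ge) (use fin that in auto)
  show thesis
  proof (rule that[of G])
    show "p \<le> G" using ge by simp
    show "G \<le> n" using G A_range[of p G] assms by auto
    fix q
    show "A p q \<longleftrightarrow> p < q \<and> q \<le> G"
      using G ge[of q] A_range[of p q] A_sub[of p G p q] by auto
  qed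
qed

end

section \<open>Band violations of the longest element against those of \<open>w\<close>\<close>

context hess_generator
begin

text \<open>A nonadjacent position that is not tall, together with an adjacent one that is, forms a
  left gap.\<close>

lemma column_cases:
  assumes "1 \<le> q" "q \<le> n" "\<And>p. A p q \<longleftrightarrow> g < p \<and> p < q" "g < q"
  shows "{1..g} \<subseteq> tall q \<or> tall q \<subseteq> {1..g}"
proof (rule ccontr)
  assume "\<not> ({1..g} \<subseteq> tall q \<or> tall q \<subseteq> {1..g})"
  then obtain p p' where p: "p \<in> {1..g}" "p \<notin> tall q" "p' \<in> tall q" "p' \<notin> {1..g}" by blast
  then have "1 \<le> p'" "p' < q" using tall_less[of p' q] by (auto simp: tall_def)
  then show False
    using generator_no_left_gap[of p p' q] p assms by (auto simp: tall_def)
qed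

lemma row_cases:
  assumes "1 \<le> p" "p \<le> n" "\<And>q. A p q \<longleftrightarrow> p < q \<and> q \<le> g" "p \<le> g" "g \<le> n"
  shows "{g<..n} \<subseteq> short p \<or> short p \<subseteq> {g<..n}"
proof (rule ccontr)
  assume "\<not> ({g<..n} \<subseteq> short p \<or> short p \<subseteq> {g<..n})"
  then obtain q q' where q: "q \<in> {g<..n}" "q \<notin> short p" "q' \<in> short p" "q' \<notin> {g<..n}" by blast
  then have "q' \<le> n" "p < q'" using short_greater[of q' p] by (auto simp: short_def)
  then show False
    using generator_no_right_gap[of q' q p] q assms by (auto simp: short_def)
qed

text \<open>If all positions up to \<open>g\<close> are tall, removing them from
  \<open>tall q\<close> and from the initial segment of the same size leaves equal numbers.
  Otherwise no adjacent position is tall.\<close>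

lemma card_column_tall:
  "card {p. A p q \<and> smax q < w p} \<le> card {p. A p q \<and> smax q < n + 1 - p}"
proof (cases "1 \<le> q \<and> q \<le> n")
  case True
  then have "1 \<le> q" "q \<le> n" by simp_all
  then obtain g where g: "g < q" "\<And>p. A p q \<longleftrightarrow> g < p \<and> p < q" by (rule A_column[of q]) auto
  have L: "{p. A p q \<and> smax q < w p} = tall q - {1..g}"
  proof (rule set_eqI)
    fix p show "p \<in> {p. A p q \<and> smax q < w p} \<longleftrightarrow> p \<in> tall q - {1..g}"
      using g(2)[of p] tall_less[of p q] True by (auto simp: tall_def)
  qed
  have R: "{p. A p q \<and> smax q < n + 1 - p} = {g<..n - smax q}"
  proof (rule set_eqI)
    fix p show "p \<in> {p. A p q \<and> smax q < n + 1 - p} \<longleftrightarrow> p \<in> {g<..n - smax q}"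
      unfolding mem_Collect_eq greaterThanAtMost_iff g(2)[of p]
      using smax_gt[of q] smax_range[of q] True by arith
  qed
  have "{1..g} \<subseteq> tall q \<or> tall q \<subseteq> {1..g}"
    by (rule column_cases) (use g True in simp_all)
  then show ?thesis
  proof
    assume "{1..g} \<subseteq> tall q"
    then show ?thesis unfolding L R using card_tall[of q] True by (simp add: card_Diff_subset)
  next
    assume "tall q \<subseteq> {1..g}"
    then have "tall q - {1..g} = {}" by blast
    then show ?thesis unfolding L by (simp only: card.empty le0)
  qed
next
  case False
  then have "\<not> A p q" for p using A_range[of p q] by auto
  then show ?thesis by simp
qed

lemma card_row_short:
  "card {q. A p q \<and> w q < pmin p} \<le> card {q. A p q \<and> n + 1 - q < pmin p}"
proof (cases "1 \<le> p \<and> p \<le> n")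
  case True
  then have "1 \<le> p" "p \<le> n" by simp_all
  then obtain g where g: "p \<le> g" "g \<le> n" "\<And>q. A p q \<longleftrightarrow> p < q \<and> q \<le> g" by (rule A_row) auto
  have L: "{q. A p q \<and> w q < pmin p} = short p - {g<..n}"
  proof (rule set_eqI)
    fix q show "q \<in> {q. A p q \<and> w q < pmin p} \<longleftrightarrow> q \<in> short p - {g<..n}"
      using g(2) g(3)[of q] short_greater[of q p] True by (auto simp: short_def)
  qed
  have "short p \<subseteq> {1..n}" by (auto simp: short_def)
  then have "short p \<subseteq> {p<..n}" using short_greater by auto
  then have "card (short p) \<le> card {p<..n}" by (intro card_mono) auto
  then have "pmin p \<le> Suc (n - p)" using card_short[of p] True by simp
  then have R: "{q. A p q \<and> n + 1 - q < pmin p} = {n + 1 - pmin p<..g}"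
  proof (intro set_eqI)
    fix q show "q \<in> {q. A p q \<and> n + 1 - q < pmin p} \<longleftrightarrow> q \<in> {n + 1 - pmin p<..g}"
      unfolding mem_Collect_eq greaterThanAtMost_iff g(3)[of q]
      using pmin_range[of p] True g(1,2) \<open>pmin p \<le> Suc (n - p)\<close> by arith
  qed
  have "{g<..n} \<subseteq> short p \<or> short p \<subseteq> {g<..n}"
    by (rule row_cases) (use g True in simp_all)
  then show ?thesis
  proof
    assume "{g<..n} \<subseteq> short p"
    then show ?thesis
      unfolding L R using card_short[of p] pmin_range[of p] True g(2) by (simp add: card_Diff_subset)
  next
    assume "short p \<subseteq> {g<..n}"
    then have "short p - {g<..n} = {}" by blast
    then show ?thesis unfolding L by (simp only: card.empty le0)
  qed
next
  case False
  then have "\<not> A p q" for q using A_range[of p q] by auto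
  then show ?thesis by simp
qed

text \<open>Pairs violating both bounds must be compared in the opposite direction, since
  inclusion-exclusion adds them back. The longest element is replaced by \<open>w\<close> in one
  coordinate at a time, here in the entry at \<open>q\<close>.\<close>

lemma card_row_both:
  "card {q. A k q \<and> smax q < n + 1 - k \<and> n + 1 - q < pmin k} \<le>
   card {q. A k q \<and> smax q < n + 1 - k \<and> w q < pmin k}" (is "card ?L \<le> card ?R")
proof (cases "?L = {}")
  case False
  then obtain q0 where q0: "A k q0" "smax q0 < n + 1 - k" "n + 1 - q0 < pmin k" by auto
  have k: "1 \<le> k" "k \<le> n" using A_range[OF q0(1)] by auto
  then obtain g where g: "k \<le> g" "g \<le> n" "\<And>q. A k q \<longleftrightarrow> k < q \<and> q \<le> g" by (rule A_row) auto
  \<comment> \<open>A pair in \<open>?L\<close> makes \<open>short k\<close> larger than the set of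
    positions after \<open>g\<close>, so \<open>row_cases\<close> leaves only the other
    inclusion.\<close>
  have "\<not> short k \<subseteq> {g<..n}"
  proof
    assume "short k \<subseteq> {g<..n}"
    then have "card (short k) \<le> card {g<..n}" by (intro card_mono) auto
    then show False using card_short[OF k] q0 g(3)[of q0] g(2) pmin_range[OF k] by (simp, arith)
  qed
  then have tail: "{g<..n} \<subseteq> short k" using row_cases k g by blast
  define S where "S = {q \<in> {1..n}. smax q < n + 1 - k}"
  have fin: "finite ?R" by (rule finite_subset[of _ "{..n}"]) (use A_range in auto)
  \<comment> \<open>Nestedness settles the comparison: if \<open>short k\<close> is the smaller set,
    \<open>?R\<close> contains all its adjacent positions and a cardinality count suffices; if
    \<open>S\<close> is, then \<open>?L\<close> is contained in \<open>?R\<close>.\<close>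
  have "short k \<subseteq> S \<or> S \<subseteq> short k"
  proof (rule ccontr)
    assume "\<not> (short k \<subseteq> S \<or> S \<subseteq> short k)"
    then obtain q1 q2 where q1: "q1 \<in> short k" "q1 \<notin> S" and q2: "q2 \<in> S" "q2 \<notin> short k" by auto
    have r: "1 \<le> q1" "q1 \<le> n" "1 \<le> q2" "q2 \<le> n" using q1 q2 by (auto simp: short_def S_def)
    have "k < q1" using short_greater q1 by blast
    have "k < q2" using smax_gt[of q2] q2 r by (auto simp: S_def)
    then have A2: "A k q2" using g(3)[of q2] subsetD[OF tail, of q2] q2 r by auto
    obtain b where b: "q1 \<le> b" "b \<le> n" "w b = smax q1" using smax_obtain r by blast
    have wb: "smax q2 < w b" using b q1 q2 r by (auto simp: S_def)
    then have "b < q2" using le_smax[of q2 b] b by (auto simp: not_less[symmetric])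
    \<comment> \<open>As \<open>q1\<close> is outside \<open>S\<close>, fewer than \<open>k\<close>
      positions are tall for it.\<close>
    have "\<exists>e\<in>{1..k}. e \<notin> tall q1"
    proof (rule ccontr)
      assume "\<not> (\<exists>e\<in>{1..k}. e \<notin> tall q1)"
      then have "card {1..k} \<le> card (tall q1)" by (intro card_mono finite_tall) auto
      then show False using card_tall[of q1] q1 r k by (auto simp: S_def)
    qed
    then obtain e where "1 \<le> e" "e \<le> k" "w e \<le> smax q1" using k by (auto simp: tall_def)
    then have "pmin k \<le> w b" using pmin_le[of e k] b by simp
    then have "q1 < b" using b q1 by (auto simp: short_def nat_less_le)
    obtain a where a: "1 \<le> a" "a \<le> k" "w a = pmin k" using pmin_obtain k by blast
    have "w a \<noteq> w q2" using above_inj[OF above_w, of a q2] a \<open>k < q2\<close> by simp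
    then have lt: "w q1 < w a" "w a < w q2" "w q2 \<le> smax q2"
      using a q1 q2 r le_smax[of q2 q2] by (auto simp: short_def)
    \<comment> \<open>The positions \<open>a, q1, b, q2\<close> carry the letters 2143. If
      \<open>a\<close> is not adjacent to \<open>q2\<close>, then \<open>a, b\<close> form a left
      gap at \<open>q2\<close>.\<close>
    show False
    proof (cases "A a q2")
      case True
      then show False
        using no_2143[of a q1 b q2] a lt wb \<open>k < q1\<close> \<open>q1 < b\<close> \<open>b < q2\<close> by simp
    next
      case False
      moreover have "A b q2" using A_sub[OF A2, of b q2] \<open>k < q1\<close> \<open>q1 < b\<close> \<open>b < q2\<close> by simp
      ultimately show False
        using generator_no_left_gap[of a b q2] a lt wb \<open>k < q1\<close> \<open>q1 < b\<close> by simp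
    qed
  qed
  then show ?thesis
  proof
    assume "short k \<subseteq> S"
    have "short k - {g<..n} \<subseteq> ?R"
    proof
      fix q assume "q \<in> short k - {g<..n}"
      then show "q \<in> ?R"
        using g(3)[of q] short_greater[of q k] subsetD[OF \<open>short k \<subseteq> S\<close>, of q] by (auto simp: short_def S_def)
    qed
    then have "card (short k - {g<..n}) \<le> card ?R" using fin by (intro card_mono)
    moreover have "q \<in> {n + 1 - pmin k<..g}" if "q \<in> ?L" for q
      using that g(3)[of q] pmin_range[OF k] by auto
    then have "?L \<subseteq> {n + 1 - pmin k<..g}" by (rule subsetI)
    then have "card ?L \<le> card {n + 1 - pmin k<..g}" by (intro card_mono) auto
    ultimately show ?thesis
      using card_short[OF k] pmin_range[OF k] g tail by (simp add: card_Diff_subset)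
  next
    assume "S \<subseteq> short k"
    have "q \<in> ?R" if "q \<in> ?L" for q
      using that A_range[of k q] subsetD[OF \<open>S \<subseteq> short k\<close>, of q] by (auto simp: short_def S_def)
    then have "?L \<subseteq> ?R" by (rule subsetI)
    then show ?thesis using fin by (intro card_mono)
  qed
next
  case True
  then show ?thesis by (simp only: card.empty le0)
qed

text \<open>Completes the exchange begun in \<open>card_row_both\<close>: with \<open>w q\<close>
  already in place, the entry at \<open>p\<close> is replaced. \<open>T\<close> takes the part of
  \<open>S\<close>; if it is not nested with \<open>tall q\<close>, a 2143 or a right gap
  results.\<close>

lemma card_column_both:
  "card {p. A p q \<and> smax q < n + 1 - p \<and> w q < pmin p} \<le>
   card {p. A p q \<and> smax q < w p \<and> w q < pmin p}" (is "card ?L \<le> card ?R")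
proof (cases "?L = {}")
  case False
  then obtain k0 where k0: "A k0 q" "smax q < n + 1 - k0" "w q < pmin k0" by auto
  have q: "1 \<le> q" "q \<le> n" using A_range[OF k0(1)] by auto
  then obtain g where g: "g < q" "\<And>p. A p q \<longleftrightarrow> g < p \<and> p < q" by (rule A_column[of q]) auto
  have "\<not> tall q \<subseteq> {1..g}"
  proof
    assume "tall q \<subseteq> {1..g}"
    then have "card (tall q) \<le> card {1..g}" by (intro card_mono) auto
    then show False using card_tall[OF q] k0 g(2)[of k0] smax_range[OF q] by (simp, arith)
  qed
  then have head: "{1..g} \<subseteq> tall q" using column_cases q g by blast
  define T where "T = {p \<in> {1..n}. w q < pmin p}"
  have "?R \<subseteq> {..n}" using A_range[of _ q] by force
  then have fin: "finite ?R" by (rule finite_subset) simp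
  have "tall q \<subseteq> T \<or> T \<subseteq> tall q"
  proof (rule ccontr)
    assume "\<not> (tall q \<subseteq> T \<or> T \<subseteq> tall q)"
    then obtain f p where f: "f \<in> tall q" "f \<notin> T" and p: "p \<in> T" "p \<notin> tall q" by auto
    have r: "1 \<le> f" "f < q" "1 \<le> p" "p \<le> n" using f p tall_less[of f q] by (auto simp: tall_def T_def)
    obtain t where t: "1 \<le> t" "t \<le> f" "w t = pmin f" using pmin_obtain r by blast
    have vals: "w t \<le> w q" "w q < pmin p" "w p \<le> smax q" "smax q < w f" "w q \<le> smax q" "pmin p \<le> w p"
      using t f p q r le_smax[of q q] pmin_le[of p p] by (auto simp: tall_def T_def)
    have "p < t" using vals pmin_le[of t p] t by (auto simp: not_less[symmetric])
    have "t < f" using vals t by (auto simp: nat_less_le)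
    have "A p q" using g(2)[of p] subsetD[OF head, of p] p r \<open>p < t\<close> \<open>t < f\<close> by auto
    obtain b where b: "q \<le> b" "b \<le> n" "w b = smax q" using smax_obtain q by blast
    have "w p \<noteq> w b" using above_inj[OF above_w, of p b] b r \<open>p < t\<close> \<open>t < f\<close> by simp
    then have "w p < w b" using vals b by simp
    show False
    proof (cases "A p b")
      case True
      then show False
        using no_2143[of p t f b] vals b r \<open>p < t\<close> \<open>t < f\<close> \<open>w p < w b\<close> by simp
    next
      case False
      moreover have "A p t" using A_sub[OF \<open>A p q\<close>, of p t] r \<open>p < t\<close> \<open>t < f\<close> by simp
      ultimately show False
        using generator_no_right_gap[of t b p] vals b r \<open>t < f\<close> \<open>w p < w b\<close> by simp
    qed
  qed
  then show ?thesis
  proof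
    assume "tall q \<subseteq> T"
    have "tall q - {1..g} \<subseteq> ?R"
    proof
      fix p assume "p \<in> tall q - {1..g}"
      then show "p \<in> ?R"
        using g(2)[of p] tall_less[of p q] subsetD[OF \<open>tall q \<subseteq> T\<close>, of p] by (auto simp: tall_def T_def)
    qed
    then have "card (tall q - {1..g}) \<le> card ?R" using fin by (intro card_mono)
    moreover have "p \<in> {g<..n - smax q}" if "p \<in> ?L" for p
      using that g(2)[of p] smax_range[OF q] by auto
    then have "?L \<subseteq> {g<..n - smax q}" by (rule subsetI)
    then have "card ?L \<le> card {g<..n - smax q}" by (intro card_mono) auto
    ultimately show ?thesis
      using card_tall[OF q] g head by (simp add: card_Diff_subset)
  next
    assume "T \<subseteq> tall q"
    have "p \<in> ?R" if "p \<in> ?L" for p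
      using that A_range[of p q] subsetD[OF \<open>T \<subseteq> tall q\<close>, of p] by (auto simp: tall_def T_def)
    then have "?L \<subseteq> ?R" by (rule subsetI)
    then show ?thesis using fin by (intro card_mono)
  qed
next
  case True
  then show ?thesis by (simp only: card.empty le0)
qed

text \<open>Inclusion-exclusion over violations of the upper and of the lower band bound.\<close>

lemma card_band_pairs_eq:
  "card (band_pairs u) + card {(p, q). A p q \<and> smax q < u p} + card {(p, q). A p q \<and> u q < pmin p} =
   card {(p, q). A p q} + card {(p, q). A p q \<and> smax q < u p \<and> u q < pmin p}"
proof -
  let ?X = "{(p, q). A p q \<and> smax q < u p}" and ?Y = "{(p, q). A p q \<and> u q < pmin p}"
  have "{(p, q). A p q} = band_pairs u \<union> (?X \<union> ?Y)" "band_pairs u \<inter> (?X \<union> ?Y) = {}"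
    by (auto simp: band_pairs_def)
  moreover have "finite (band_pairs u)" "finite ?X" "finite ?Y"
    unfolding band_pairs_def by (rule finite_A)+
  ultimately have "card {(p, q). A p q} = card (band_pairs u) + card (?X \<union> ?Y)"
    by (simp add: card_Un_disjoint)
  moreover have "card ?X + card ?Y = card (?X \<union> ?Y) + card (?X \<inter> ?Y)"
    using \<open>finite ?X\<close> \<open>finite ?Y\<close> by (rule card_Un_Int)
  moreover have "?X \<inter> ?Y = {(p, q). A p q \<and> smax q < u p \<and> u q < pmin p}" by auto
  ultimately show ?thesis by simp
qed

text \<open>\<open>w\<close> has at most as many violations of each bound as the longest element,
  and at least as many double violations; both effects favour \<open>w\<close> in
  \<open>card_band_pairs_eq\<close>.\<close>

lemma card_band_pairs_longest_le: "card (band_pairs (longest_perm n)) \<le> card (band_pairs w)"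
proof -
  let ?l = "longest_perm n"
  have l: "?l p = n + 1 - p" "?l q = n + 1 - q" if "A p q" for p q
    using A_range[OF that] by (simp_all add: longest_perm_def)
  have eqs: "{(p, q). A p q \<and> smax q < ?l p} = {(p, q). A p q \<and> smax q < n + 1 - p}"
    "{(p, q). A p q \<and> ?l q < pmin p} = {(p, q). A p q \<and> n + 1 - q < pmin p}"
    "{(p, q). A p q \<and> smax q < ?l p \<and> ?l q < pmin p} =
      {(p, q). A p q \<and> smax q < n + 1 - p \<and> n + 1 - q < pmin p}"
    using l by auto
  have r: "A p q \<Longrightarrow> p \<le> n \<and> q \<le> n" for p q using A_range[of p q] by simp
  have "card {(p, q). A p q \<and> smax q < w p} \<le> card {(p, q). A p q \<and> smax q < n + 1 - p}"
    by (rule card_pairs_le_if_sections_le(2)[of _ n]) (use r card_column_tall in blast)+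
  moreover have "card {(p, q). A p q \<and> w q < pmin p} \<le> card {(p, q). A p q \<and> n + 1 - q < pmin p}"
    by (rule card_pairs_le_if_sections_le(1)[of _ n]) (use r card_row_short in blast)+
  moreover have "card {(p, q). A p q \<and> smax q < n + 1 - p \<and> n + 1 - q < pmin p} \<le>
      card {(p, q). A p q \<and> smax q < n + 1 - p \<and> w q < pmin p}"
    by (rule card_pairs_le_if_sections_le(1)[of _ n]) (use r card_row_both in blast)+
  moreover have "\<dots> \<le> card {(p, q). A p q \<and> smax q < w p \<and> w q < pmin p}"
    by (rule card_pairs_le_if_sections_le(2)[of _ n]) (use r card_column_both in blast)+
  ultimately show ?thesis
    using card_band_pairs_eq[of ?l] card_band_pairs_eq[of w] unfolding eqs by linarith
qed

lemma card_up_pairs_eq: "card (up_pairs (longest_perm n)) = card (up_pairs w)"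
  using card_band_pairs_longest_le band_pairs_longest generator_band_pairs_w
    card_up_pairs_le_longest[OF above_w] by simp

end

section \<open>The corresponding generator\<close>

definition hess_adj :: "nat \<Rightarrow> (nat \<Rightarrow> nat) \<Rightarrow> nat \<Rightarrow> nat \<Rightarrow> bool" where
  "hess_adj n h i j \<longleftrightarrow> 1 \<le> i \<and> i < j \<and> j \<le> n \<and> j \<le> h i"

definition same_comparisons :: "nat \<Rightarrow> (nat \<Rightarrow> nat) \<Rightarrow> (nat \<Rightarrow> nat) \<Rightarrow> (nat \<Rightarrow> nat) \<Rightarrow> bool" where
  "same_comparisons n h g w \<longleftrightarrow> (\<forall>i j. hess_adj n h i j \<longrightarrow> (g i < g j \<longleftrightarrow> w i < w j))"

lemma hess_perm_hess_adj:
  assumes "hessenberg_function n h" "w permutes {1..n}"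
  shows "hess_perm n (hess_adj n h) w"
proof
  show "hess_adj n h i j \<Longrightarrow> 1 \<le> i \<and> i < j \<and> j \<le> n" for i j
    by (simp add: hess_adj_def)
  show "hess_adj n h i' j'" if "hess_adj n h i j" "i \<le> i'" "i' < j'" "j' \<le> j" for i j i' j'
  proof -
    have "i \<in> {1..n}" "i' \<in> {1..n}" using that by (auto simp: hess_adj_def)
    then have "h i \<le> h i'"
      using assms(1) that(2) unfolding hessenberg_function_def by (meson mono_onD)
    then show ?thesis using that by (auto simp: hess_adj_def)
  qed
qed (fact assms(2))

text \<open>Among the values from \<open>g p\<close> up to \<open>g q\<close>, take the last one
  below \<open>g q\<close> located at or left of \<open>p\<close>. Its successor lies right of
  \<open>p\<close>, within reach by the generator condition, and is therefore adjacent to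
  \<open>p\<close>. Either the path continues from there, or that position is already at or beyond
  \<open>q\<close>, which makes \<open>p, q\<close> adjacent.\<close>

lemma generator_climb_path:
  assumes h: "hessenberg_function n h" and g: "generator n h g"
    and "1 \<le> p" "p < q" "q \<le> n" "g p < g q"
  shows "(\<lambda>x y. hess_adj n h x y \<and> g x < g y)\<^sup>*\<^sup>* p q"
  using assms(3-)
proof (induction "q - p" arbitrary: p rule: less_induct)
  case less
  have perm: "g permutes {1..n}" using g by (simp add: generator_def)
  interpret hess_perm n "hess_adj n h" g using hess_perm_hess_adj[OF h perm] .
  have val: "g (inv g v) = v" for v using permutes_inverses[OF perm] by simp
  have pos: "inv g (g x) = x" for x using permutes_inverses[OF perm] by simp
  define V where "V = {v. g p \<le> v \<and> v < g q \<and> inv g v \<le> p}"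
  have "finite V" unfolding V_def by (rule finite_subset[of _ "{..<g q}"]) auto
  moreover have "g p \<in> V" using less.prems pos by (simp add: V_def)
  ultimately have "Max V \<in> V" and ge: "\<And>v. v \<in> V \<Longrightarrow> v \<le> Max V"
    using Max_in[of V] Max_ge[of V] by blast+
  define v where "v = Max V"
  have v: "g p \<le> v" "v < g q" "inv g v \<le> p" using \<open>Max V \<in> V\<close> by (simp_all add: V_def v_def)
  define c where "c = inv g (v + 1)"
  have gc: "g c = v + 1" by (simp add: c_def val)
  have "p < c"
  proof (cases "v + 1 < g q")
    case True
    have "v + 1 \<notin> V" using ge[of "v + 1"] by (auto simp: v_def)
    then show ?thesis using True v by (auto simp: V_def c_def)
  next
    case False
    then have "g c = g q" using gc v by simp
    then show ?thesis using pos less.prems by metis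
  qed
  have gq: "1 \<le> g p" "g q \<le> n"
    using permutes_in_image[OF perm, of p] permutes_in_image[OF perm, of q] less.prems by auto
  then have "g c \<in> {1..n}" using gc v by simp
  then have c: "c \<le> n" using permutes_in_image[OF perm, of c] by simp
  have "v \<in> {1..n}" using gq v by simp
  then have x: "inv g v \<in> {1..n}" using permutes_in_image[OF permutes_inv[OF perm]] by blast
  have "g (inv g v) \<le> n - 1" using val[of v] gq v by simp
  then have "inv g (g (inv g v) + 1) \<le> h (inv g v)"
    using g x unfolding generator_def by blast
  then have "c \<le> h (inv g v)" by (simp only: val c_def)
  then have "hess_adj n h (inv g v) c" using x v(3) \<open>p < c\<close> c by (simp add: hess_adj_def)
  then have A: "hess_adj n h p c" using A_sub v(3) \<open>p < c\<close> by blast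
  show ?case
  proof (cases "c < q")
    case True
    have "g c \<noteq> g q" using pos True by (metis less_irrefl)
    then have "g c < g q" using gc v by simp
    then have "(\<lambda>x y. hess_adj n h x y \<and> g x < g y)\<^sup>*\<^sup>* c q"
      using less.hyps[of c] less.prems True \<open>p < c\<close> by simp
    then show ?thesis
      using A gc v by (intro converse_rtranclp_into_rtranclp[of _ p c]) auto
  next
    case False
    then have "hess_adj n h p q" using A_sub[OF A, of p q] less.prems by simp
    then show ?thesis using less.prems by (intro r_into_rtranclp) simp
  qed
qed

text \<open>Every step of an increasing path compares adjacent positions, so the path is increasing
  for \<open>g'\<close> too.\<close>

lemma generator_less_transfer:
  assumes h: "hessenberg_function n h" and "generator n h g" "same_comparisons n h g g'"
    and "1 \<le> p" "p < q" "q \<le> n" "g p < g q"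
  shows "g' p < g' q"
proof -
  have "x = y \<or> g' x < g' y" if "(\<lambda>x y. hess_adj n h x y \<and> g x < g y)\<^sup>*\<^sup>* x y" for x y
    using that
    by (induction rule: rtranclp_induct) (use assms(3) in \<open>auto simp: same_comparisons_def\<close>)
  then show ?thesis using generator_climb_path[OF assms(1,2,4-7)] assms(5) by blast
qed

text \<open>Adjacent comparisons determine all comparisons in a generator, and a permutation is
  recovered from these by ranking its entries.\<close>

lemma generator_unique:
  assumes h: "hessenberg_function n h"
    and g: "generator n h g" "same_comparisons n h g w"
    and g': "generator n h g'" "same_comparisons n h g' w"
  shows "g = g'"
proof
  have perm: "g permutes {1..n}" "g' permutes {1..n}" using g g' by (simp_all add: generator_def)
  have gg': "same_comparisons n h g g'" "same_comparisons n h g' g"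
    using g g' by (simp_all add: same_comparisons_def)
  have less_iff: "g p < g q \<longleftrightarrow> g' p < g' q" if "p < q" "1 \<le> p" "q \<le> n" for p q
    using generator_less_transfer[OF h g(1) gg'(1)] generator_less_transfer[OF h g'(1) gg'(2)] that by blast
  have le: "g x \<le> g p \<longleftrightarrow> g' x \<le> g' p" if "x \<in> {1..n}" "p \<in> {1..n}" for x p
  proof (cases x p rule: linorder_cases)
    case less
    then have "g x \<noteq> g p" "g' x \<noteq> g' p" using perm permutes_inj by (metis injD less_irrefl)+
    then show ?thesis using less_iff[of x p] that less by (simp add: order_le_less)
  next
    case greater
    then show ?thesis using less_iff[of p x] that by (simp add: not_less[symmetric])
  qed simp
  fix p
  show "g p = g' p"
  proof (cases "p \<in> {1..n}")
    case True
    have rank: "f p = card {x \<in> {1..n}. f x \<le> f p}" if f: "f permutes {1..n}" for f :: "nat \<Rightarrow> nat"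
    proof -
      have "f p \<in> {1..n}" using True permutes_in_image[OF f] by simp
      then have "card {x \<in> {1..n}. f x \<in> {1..f p}} = f p"
        using card_permutes_values[OF f, of "{1..f p}"] by simp
      moreover have "{x \<in> {1..n}. f x \<in> {1..f p}} = {x \<in> {1..n}. f x \<le> f p}"
      proof -
        have "f x \<in> {1..f p} \<longleftrightarrow> f x \<le> f p" if "x \<in> {1..n}" for x
          using permutes_in_image[OF f, of x] that by simp
        then show ?thesis by auto
      qed
      ultimately show ?thesis by simp
    qed
    have "{x \<in> {1..n}. g x \<le> g p} = {x \<in> {1..n}. g' x \<le> g' p}" using le True by auto
    then show ?thesis using rank[OF perm(1)] rank[OF perm(2)] by simp
  next
    case False
    then show ?thesis using perm by (simp add: permutes_def)
  qed
qed

text \<open>A permutation with the prescribed comparisons and the most inversions is a generator: otherwise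
  swapping two consecutive values at positions that are not adjacent would create an inversion.\<close>

lemma generator_exists:
  assumes h: "hessenberg_function n h" and w: "w permutes {1..n}"
  obtains g where "generator n h g" "same_comparisons n h g w"
proof -
  let ?P = "\<lambda>g. g permutes {1..n} \<and> same_comparisons n h g w"
  have "card (inversion_set n g) < Suc (n * n)" for g
  proof -
    have "card (inversion_set n g) \<le> card ({1..n} \<times> {1..n})"
      by (rule card_mono) (auto simp: inversion_set_def)
    then show ?thesis by simp
  qed
  moreover have "?P w" using w by (simp add: same_comparisons_def)
  ultimately obtain g where g: "?P g"
    and greatest: "\<And>g'. ?P g' \<Longrightarrow> card (inversion_set n g') \<le> card (inversion_set n g)"
    using ex_has_greatest_nat[of ?P w "\<lambda>g. card (inversion_set n g)" "Suc (n * n)"] by (metis less_imp_le)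
  have perm: "g permutes {1..n}" using g by simp
  have "inv g (g i + 1) \<le> h i" if i: "i \<in> {1..n}" "g i \<le> n - 1" for i
  proof (rule ccontr)
    assume not_le: "\<not> inv g (g i + 1) \<le> h i"
    define j where "j = inv g (g i + 1)"
    have gj: "g j = g i + 1" using permutes_inverses[OF perm] by (simp add: j_def)
    have "i \<le> h i" using h i by (simp add: hessenberg_function_def)
    then have "i < j" "h i < j" using not_le by (simp_all add: j_def)
    have "g j \<in> {1..n}" using gj i by auto
    then have "j \<le> n" using permutes_in_image[OF perm, of j] by simp
    let ?g = "g \<circ> transpose i j"
    have "?g permutes {1..n}"
      using transpose_permutes[OF perm] i \<open>i < j\<close> \<open>j \<le> n\<close> by simp
    moreover have "same_comparisons n h ?g w"
      unfolding same_comparisons_def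
    proof (intro allI impI)
      fix p q assume A: "hess_adj n h p q"
      have "p \<noteq> i \<or> q \<noteq> j" "p < q" using A \<open>h i < j\<close> by (auto simp: hess_adj_def)
      have inj: "g x = g y \<longleftrightarrow> x = y" for x y using permutes_inj[OF perm] by (metis injD)
      have "?g p < ?g q \<longleftrightarrow> g p < g q"
      proof -
        \<comment> \<open>No value lies strictly between the consecutive values \<open>g i\<close>
          and \<open>g j\<close>, so the swap only alters the comparison of \<open>i\<close> with
          \<open>j\<close> themselves.\<close>
        have ne: "x \<noteq> j \<Longrightarrow> g x \<noteq> g i + 1" "x \<noteq> i \<Longrightarrow> g x \<noteq> g i" for x
          using inj[of x j] inj[of x i] gj by simp_all
        show ?thesis
          using ne[of p] ne[of q] \<open>p \<noteq> i \<or> q \<noteq> j\<close> \<open>p < q\<close> \<open>i < j\<close> gj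
          by (auto simp: transpose_def)
      qed
      then show "?g p < ?g q \<longleftrightarrow> w p < w q" using g A by (simp add: same_comparisons_def)
    qed
    ultimately have "card (inversion_set n ?g) \<le> card (inversion_set n g)" using greatest by blast
    then show False
      using card_inversion_set_less[of i j n g] i \<open>i < j\<close> \<open>j \<le> n\<close> gj by simp
  qed
  then have "generator n h g" using perm by (simp add: generator_def)
  then show thesis using that g by blast
qed

lemma corresponding_generator:
  assumes "hessenberg_function n h" "w permutes {1..n}"
  shows "generator n h (corresponding_generator n h w)"
    and "same_comparisons n h (corresponding_generator n h w) w"
proof -
  have "\<exists>!g. generator n h g \<and> same_comparisons n h g w"
    using generator_exists[OF assms] generator_unique[OF assms(1)] by metis
  moreover have "corresponding_generator n h w = (THE g. generator n h g \<and> same_comparisons n h g w)"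
    by (simp only: corresponding_generator_def same_comparisons_def hess_adj_def)
  ultimately show "generator n h (corresponding_generator n h w)"
    "same_comparisons n h (corresponding_generator n h w) w"
    using theI'[of "\<lambda>g. generator n h g \<and> same_comparisons n h g w"] by simp_all
qed

text \<open>The four five-letter patterns together only compare adjacent positions.\<close>

lemma contains_five_letter_iff:
  assumes "w permutes {1..n}"
  shows "contains_25314 n h w \<or> contains_24315 n h w \<or> contains_14325 n h w \<or> contains_15324 n h w \<longleftrightarrow>
    (\<exists>i j k l m. admissible5 n h i j k l m \<and> w i < w k \<and> w l < w k \<and> w k < w j \<and> w k < w m)"
    (is "?L \<longleftrightarrow> ?R")
proof
  assume ?L
  then show ?R
    unfolding contains_25314_def contains_24315_def contains_14325_def contains_15324_def
    by (elim disjE exE conjE) (intro exI conjI, assumption, linarith+)+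
next
  assume ?R
  then obtain i j k l m where *: "admissible5 n h i j k l m"
    "w i < w k" "w l < w k" "w k < w j" "w k < w m" by blast
  \<comment> \<open>These are the two comparisons left open by the merged condition; their four
    outcomes are the four patterns.\<close>
  have "i < l" "j < m" using *(1) by (auto simp: admissible5_def)
  then have "w i \<noteq> w l" "w j \<noteq> w m" using permutes_inj[OF assms] by (auto dest: injD)
  then consider "w l < w i" "w m < w j" | "w l < w i" "w j < w m" | "w i < w l" "w j < w m" | "w i < w l" "w m < w j"
    by linarith
  then show ?L
    unfolding contains_25314_def contains_24315_def contains_14325_def contains_15324_def
    using * by cases blast+
qed

lemma avoids_iff_not_contains:
  assumes "hessenberg_function n h" "w permutes {1..n}"
  shows "hess_perm.avoids (hess_adj n h) w \<longleftrightarrow>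
    \<not> contains_2143 n h w \<and> \<not> contains_1324 n h w \<and> \<not> contains_1243 n h w \<and>
    \<not> contains_2134 n h w \<and> \<not> contains_1423 n h w \<and> \<not> contains_2314 n h w \<and>
    \<not> contains_25314 n h w \<and> \<not> contains_24315 n h w \<and>
    \<not> contains_14325 n h w \<and> \<not> contains_15324 n h w"
proof -
  interpret hess_perm n "hess_adj n h" w using hess_perm_hess_adj[OF assms] .
  let ?A = "hess_adj n h"
  let ?o = "\<lambda>i j k l::nat. i < j \<and> j < k \<and> k < l"
  have "\<not> contains_2143 n h w \<longleftrightarrow> (\<forall>i j k l. ?o i j k l \<longrightarrow>
      \<not> (?A i l \<and> w j < w i \<and> w i < w l \<and> w l < w k))"
    unfolding contains_2143_def hess_adj_def not_ex by (intro iff_allI) auto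
  moreover have "\<not> contains_1324 n h w \<longleftrightarrow> (\<forall>i j k l. ?o i j k l \<longrightarrow>
      \<not> (?A i k \<and> ?A j l \<and> w i < w k \<and> w k < w j \<and> w j < w l))"
    unfolding contains_1324_def hess_adj_def not_ex by (intro iff_allI) auto
  moreover have "\<not> contains_1243 n h w \<longleftrightarrow> (\<forall>i j k l. ?o i j k l \<longrightarrow>
      \<not> (?A i j \<and> ?A j l \<and> \<not> ?A i l \<and> w i < w j \<and> w j < w l \<and> w l < w k))"
    unfolding contains_1243_def hess_adj_def not_ex by (intro iff_allI) auto
  moreover have "\<not> contains_2134 n h w \<longleftrightarrow> (\<forall>i j k l. ?o i j k l \<longrightarrow>
      \<not> (?A i k \<and> ?A k l \<and> \<not> ?A i l \<and> w j < w i \<and> w i < w k \<and> w k < w l))"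
    unfolding contains_2134_def hess_adj_def not_ex by (intro iff_allI) auto
  moreover have "\<not> contains_1423 n h w \<longleftrightarrow> (\<forall>i j k l. ?o i j k l \<longrightarrow>
      \<not> (?A i k \<and> ?A j l \<and> \<not> ?A i l \<and> w i < w k \<and> w k < w l \<and> w l < w j))"
    unfolding contains_1423_def hess_adj_def not_ex by (intro iff_allI) auto
  moreover have "\<not> contains_2314 n h w \<longleftrightarrow> (\<forall>i j k l. ?o i j k l \<longrightarrow>
      \<not> (?A i k \<and> ?A j l \<and> \<not> ?A i l \<and> w k < w i \<and> w i < w j \<and> w j < w l))"
    unfolding contains_2314_def hess_adj_def not_ex by (intro iff_allI) auto
  moreover have "\<not> contains_25314 n h w \<and> \<not> contains_24315 n h w \<and>
      \<not> contains_14325 n h w \<and> \<not> contains_15324 n h w \<longleftrightarrow>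
    (\<forall>i j k l m. i < j \<and> j < k \<and> k < l \<and> l < m \<longrightarrow>
      \<not> (?A i k \<and> \<not> ?A i l \<and> ?A j l \<and> \<not> ?A j m \<and> ?A k m \<and>
         w i < w k \<and> w l < w k \<and> w k < w j \<and> w k < w m))"
    unfolding de_Morgan_disj[symmetric] contains_five_letter_iff[OF assms(2)] admissible5_def
      hess_adj_def not_ex
    by (intro iff_allI) auto
  ultimately show ?thesis
    unfolding avoids_def imp_conjR all_conj_distrib by (simp only: conj_assoc)
qed

text \<open>Each clause of \<open>avoids\<close> compares only positions whose adjacency the clause
  itself implies, so \<open>four\<close> and \<open>five\<close> reduce the equivalence to
  propositional logic.\<close>

lemma avoids_cong:
  assumes "hessenberg_function n h" "w permutes {1..n}" "g permutes {1..n}" "same_comparisons n h g w"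
  shows "hess_perm.avoids (hess_adj n h) g \<longleftrightarrow> hess_perm.avoids (hess_adj n h) w"
proof -
  interpret g: hess_perm n "hess_adj n h" g using hess_perm_hess_adj[OF assms(1,3)] .
  interpret w: hess_perm n "hess_adj n h" w using hess_perm_hess_adj[OF assms(1,2)] .
  let ?A = "hess_adj n h"
  let ?s = "\<lambda>i j. ?A i j \<longrightarrow> (g i < g j \<longleftrightarrow> w i < w j) \<and> (g j < g i \<longleftrightarrow> w j < w i)"
  have less: "g i < g j \<longleftrightarrow> w i < w j" "g j < g i \<longleftrightarrow> w j < w i" if "hess_adj n h i j" for i j
  proof -
    show *: "g i < g j \<longleftrightarrow> w i < w j" using assms(4) that by (simp add: same_comparisons_def)
    have "g i \<noteq> g j" "w i \<noteq> w j"
      using g.above_inj[OF g.above_w] w.above_inj[OF w.above_w] g.A_range[OF that] by simp_all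
    then show "g j < g i \<longleftrightarrow> w j < w i" using * by linarith
  qed
  have four: "(?A i l \<longrightarrow> ?A i j \<and> ?A k l) \<and> (?A i k \<longrightarrow> ?A i j \<and> ?A j k) \<and> (?A j l \<longrightarrow> ?A k l) \<and>
      ?s i j \<and> ?s i k \<and> ?s i l \<and> ?s j k \<and> ?s j l \<and> ?s k l"
    if "i < j \<and> j < k \<and> k < l" for i j k l
    using that less[of i j] less[of i k] less[of i l] less[of j k] less[of j l] less[of k l]
      g.A_sub[of i l i j] g.A_sub[of i l k l] g.A_sub[of i k i j] g.A_sub[of i k j k] g.A_sub[of j l k l]
    by simp
  have five: "(?A i k \<longrightarrow> ?A j k) \<and> (?A j l \<longrightarrow> ?A k l) \<and> ?s i k \<and> ?s j k \<and> ?s k l \<and> ?s k m"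
    if "i < j \<and> j < k \<and> k < l \<and> l < m" for i j k l m
    using that less[of i k] less[of j k] less[of k l] less[of k m] g.A_sub[of i k j k] g.A_sub[of j l k l]
    by simp
  show ?thesis
    unfolding g.avoids_def w.avoids_def
    by (intro arg_cong2[where f = "(\<and>)"] iff_allI imp_cong refl; (drule four, argo)?; drule five; argo)
qed

section \<open>The graph of a Hessenberg Schubert variety\<close>

lemma transpose_eq_imp:
  fixes p q p' q' :: "'a::linorder"
  assumes "transpose p q = transpose p' q'" "p < q" "p' < q'"
  shows "p = p' \<and> q = q'"
proof -
  have "transpose p' q' p = q"
    using fun_cong[OF assms(1), of p] by simp
  then show ?thesis
    using assms(2,3) by (auto simp: transpose_def split: if_splits)
qed

context hess_perm
begin

text \<open>Distinct pairs give distinct neighbours, so counting pairs is counting edges.\<close>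

lemma inj_up_pairs:
  assumes "inj f"
  shows "inj_on (\<lambda>(p, q). f \<circ> transpose p q) (up_pairs u)"
proof (rule inj_onI, clarify)
  fix p q p' q'
  assume *: "(p, q) \<in> up_pairs u" "(p', q') \<in> up_pairs u" "f \<circ> transpose p q = f \<circ> transpose p' q'"
  then have "transpose p q = transpose p' q'"
    using assms by (simp add: fun_eq_iff inj_eq)
  then show "p = p' \<and> q = q'"
    using * A_range[of p q] A_range[of p' q'] by (intro transpose_eq_imp) (auto simp: up_pairs_def)
qed

lemma up_pairs_const_iff:
  "(\<forall>u v. above u \<longrightarrow> above v \<longrightarrow> card (up_pairs u) = card (up_pairs v)) \<longleftrightarrow>
   card (up_pairs (longest_perm n)) = card (up_pairs w)"
proof
  assume "card (up_pairs (longest_perm n)) = card (up_pairs w)"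
  then have "card (up_pairs u) = card (up_pairs w)" if "above u" for u
    using card_up_pairs_ge_w[OF that] card_up_pairs_le_longest[OF that] by simp
  then show "\<forall>u v. above u \<longrightarrow> above v \<longrightarrow> card (up_pairs u) = card (up_pairs v)" by simp
qed (use above_w above_longest in blast)

end

lemma hess_generator_hess_adj:
  assumes h: "hessenberg_function n h" and g: "generator n h g" "hess_perm.avoids (hess_adj n h) g"
  shows "hess_generator n (hess_adj n h) g"
proof -
  have "g permutes {1..n}" using g by (simp add: generator_def)
  then interpret hess_perm n "hess_adj n h" g using hess_perm_hess_adj[OF h] by blast
  show ?thesis
  proof
    show "climb\<^sup>*\<^sup>* p q" if "1 \<le> p" "p < q" "q \<le> n" "g p < g q" for p q
      using generator_climb_path[OF h g(1) that] unfolding climb_def[abs_def] .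
  qed (fact g(2))
qed

lemma regular_graph_hess_schubert_graph_iff:
  assumes h: "hessenberg_function n h" and w: "w permutes {1..n}"
  defines "g \<equiv> corresponding_generator n h w"
  shows "regular_graph (hess_schubert_graph n w h) \<longleftrightarrow>
    card (hess_perm.up_pairs n (hess_adj n h) g (longest_perm n)) = card (hess_perm.up_pairs n (hess_adj n h) g g)"
proof -
  have perm: "g permutes {1..n}"
    using corresponding_generator(1)[OF h w] by (simp add: g_def generator_def)
  interpret hess_perm n "hess_adj n h" g using hess_perm_hess_adj[OF h perm] .
  \<comment> \<open>Swapping positions is multiplication on the right, so it commutes with left
    multiplication by \<open>s\<close>.\<close>
  define s where "s = w \<circ> inv g"
  have s: "s permutes {1..n}"
    unfolding s_def by (rule permutes_compose[OF permutes_inv[OF perm] assms(2)])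
  then have "inj s" by (rule permutes_inj)
  have interval: "bruhat_interval n g (longest_perm n) = {u. above u}"
    using bruhat_le_longest_perm by (auto simp: bruhat_interval_def above_def)
  have verts: "fixed_points n w h = (\<lambda>u. s \<circ> u) ` {u. above u}"
    by (simp add: fixed_points_def Let_def s_def flip: g_def interval)
  have mem: "s \<circ> u \<in> fixed_points n w h \<longleftrightarrow> above u" for u
  proof -
    have "s \<circ> u = s \<circ> u' \<Longrightarrow> u = u'" for u'
      using \<open>inj s\<close> by (simp add: fun_eq_iff inj_eq)
    then show ?thesis unfolding verts by auto
  qed
  have degree: "out_degree (hess_schubert_graph n w h) (s \<circ> u) = card (up_pairs u)" if u: "above u" for u
  proof -
    have su: "(s \<circ> u) permutes {1..n}"
      using permutes_compose[OF _ s] u by (auto simp: above_def)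
    have "out_arcs (hess_schubert_graph n w h) (s \<circ> u) =
        (\<lambda>v. (s \<circ> u, v)) ` (\<lambda>(p, q). s \<circ> u \<circ> transpose p q) ` up_pairs u" (is "?L = ?R")
    proof
      show "?L \<subseteq> ?R"
      proof
        fix e assume "e \<in> ?L"
        then obtain p q where e: "e = (s \<circ> u, s \<circ> u \<circ> transpose p q)" "hess_adj n h p q"
            "s \<circ> u \<circ> transpose p q \<in> fixed_points n w h"
          by (auto simp: out_arcs_def hess_schubert_graph_def induce_subgraph_def hess_graph_def
              swap_positions_def hess_adj_def)
        then have "(p, q) \<in> up_pairs u"
          using mem[of "u \<circ> transpose p q"] by (simp add: up_pairs_def comp_assoc)
        then show "e \<in> ?R" unfolding image_image e(1) by (intro image_eqI[of _ _ "(p, q)"]) simp_all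
      qed
      show "?R \<subseteq> ?L"
      proof
        fix e assume "e \<in> ?R"
        then obtain p q where e: "e = (s \<circ> u, s \<circ> u \<circ> transpose p q)" "(p, q) \<in> up_pairs u" by auto
        then have A: "hess_adj n h p q" and "above (u \<circ> transpose p q)" by (simp_all add: up_pairs_def)
        then have "s \<circ> u \<circ> transpose p q \<in> fixed_points n w h"
          using mem[of "u \<circ> transpose p q"] by (simp add: comp_assoc)
        moreover have "e \<in> parcs (hess_graph n h)"
          using e A su unfolding hess_graph_def swap_positions_def hess_adj_def by auto
        ultimately show "e \<in> ?L"
          using e(1) mem[of u] u
          by (simp add: out_arcs_def hess_schubert_graph_def induce_subgraph_def)
      qed
    qed
    moreover have "inj (s \<circ> u)" using permutes_inj[OF su] .
    ultimately show ?thesis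
      using card_image[OF inj_up_pairs[OF \<open>inj (s \<circ> u)\<close>, of u]]
      by (simp add: out_degree_def card_image inj_on_def)
  qed
  have "verts (hess_schubert_graph n w h) = (\<lambda>u. s \<circ> u) ` {u. above u}"
    by (simp add: hess_schubert_graph_def verts)
  then have "regular_graph (hess_schubert_graph n w h) \<longleftrightarrow>
      (\<forall>u v. above u \<longrightarrow> above v \<longrightarrow> card (up_pairs u) = card (up_pairs v))"
    unfolding regular_graph_def using degree by auto
  then show ?thesis using up_pairs_const_iff by simp
qed

theorem theorem4p14:
  fixes n :: nat and h w :: "nat \<Rightarrow> nat"
  assumes "hessenberg_function n h"
    and "w permutes {1..n}"
  shows "regular_graph (hess_schubert_graph n w h) \<longleftrightarrow>
    \<not> contains_2143 n h w \<and> \<not> contains_1324 n h w \<and> \<not> contains_1243 n h w \<and>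
    \<not> contains_2134 n h w \<and> \<not> contains_1423 n h w \<and> \<not> contains_2314 n h w \<and>
    \<not> contains_25314 n h w \<and> \<not> contains_24315 n h w \<and>
    \<not> contains_14325 n h w \<and> \<not> contains_15324 n h w"
proof -
  define g where "g = corresponding_generator n h w"
  have g: "generator n h g" "same_comparisons n h g w"
    unfolding g_def by (fact corresponding_generator[OF assms])+
  then have perm: "g permutes {1..n}" by (simp add: generator_def)
  interpret hess_perm n "hess_adj n h" g using hess_perm_hess_adj[OF assms(1) perm] .
  have "card (up_pairs (longest_perm n)) = card (up_pairs g) \<longleftrightarrow> avoids"
  proof
    assume avoids
    then interpret hess_generator n "hess_adj n h" g
      using hess_generator_hess_adj[OF assms(1) g(1)] by blast
    show "card (up_pairs (longest_perm n)) = card (up_pairs g)" by (rule card_up_pairs_eq)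
  qed (rule avoids_if_card_eq)
  then show ?thesis
    using regular_graph_hess_schubert_graph_iff[OF assms] avoids_cong[OF assms perm g(2)]
      avoids_iff_not_contains[OF assms] unfolding g_def[symmetric] by blast
qed

end
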